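(* Let $\Omega \subset \mathbb{R}^3$ be a bounded, simply connected Lipschitz domain, let $\mathcal{T}_h$ be a regular tetrahedral mesh of $\Omega$, and let $p \ge 1$ be an integer. Let $w:\mathbb{R}^3\times\Omega\to\mathbb{R}$, $(\mathbf{b},x)\mapsto w(\mathbf{b},x)$, be piecewise smooth in $\mathbf{b}$ and smooth in $x$, with derivative $\partial_{\mathbf{b}} w$ satisfying, for some constants $\gamma, L>0$ and for all $x\in\Omega$ and all $\mathbf{b},\mathbf{b}'\in\mathbb{R}^3$, $$\langle \partial_{\mathbf{b}} w(\mathbf{b},x)-\partial_{\mathbf{b}} w(\mathbf{b}',x),\,\mathbf{b}-\mathbf{b}'\rangle \ge \gamma\,|\mathbf{b}-\mathbf{b}'|^2, \qquad |\partial_{\mathbf{b}} w(\mathbf{b},x)-\partial_{\mathbf{b}} w(\mathbf{b}',x)|\le L\,|\mathbf{b}-\mathbf{b}'|.$$ Let $\mathbf{h}_s\in H(\operatorname{curl};\Omega)$ have well-defined values at the quadrature points. Let $Q_h$, $V_h$ and the quadrature-based product $\langle\cdot,\cdot\rangle_h$ (with positive weights, exact for polynomials of degree $\le 2p-2$ on every element) be as defined in the context. Then there exists a unique pair $(\mathbf{b}_h,\psi_h)\in Q_h\times V_h$ such that $$\langle \partial_{\mathbf{b}} w(\mathbf{b}_h),\mathbf{b}_h'\rangle_h+\langle\nabla\psi_h,\mathbf{b}_h'\rangle_h=\langle\mathbf{h}_s,\mathbf{b}_h'\rangle_h\qquad\text{for all }\mathbf{b}_h'\in Q_h,$$ $$\langle\mathbf{b}_h,\nabla\psi_h'\rangle_h=0\qquad\text{for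 all }\psi_h'\in V_h.$$
   Context: $\langle a,b\rangle$ denotes the Euclidean scalar product on $\mathbb{R}^3$ and $|\cdot|$ the Euclidean norm. $H(\operatorname{curl};\Omega)$ is the space of vector fields in $L^2(\Omega)^3$ whose distributional curl lies in $L^2(\Omega)^3$. Mesh: $\mathcal{T}_h$ is a finite conforming (and shape-regular) partition of $\Omega$ into non-degenerate tetrahedra $T$, in the usual finite element sense. Finite element spaces: $Q_h=P_{p-1}(\mathcal{T}_h)^3$ is the space of all vector fields on $\Omega$ whose components are, on each $T\in\mathcal{T}_h$, polynomials of degree $\le p-1$ (no continuity between elements is required). $V_h=P_p(\mathcal{T}_h)\cap H^1(\Omega)/\mathbb{R}$ is the space of all continuous functions on $\Omega$ that are polynomials of degree $\le p$ on each $T\in\mathcal{T}_h$ and have zero average over $\Omega$. Quadrature-based product: $\langle a,b\rangle_h=\sum_{T\in\mathcal{T}_h}\langle a,b\rangle_{T,h}$, where $\langle a,b\rangle_{T,h}=\sum_{i}\omega_{T,i}\,\langle a(x_{T,i}),b(x_{T,i})\rangle$ is obtained from a quadrature rule on $T$ with finitely many points $x_{T,i}$ in $T$ and weights $\omega_{T,i}>0$, which integrates all polynomials of degree $\le 2p-2$ over $T$ exactly. Piecewise polynomial functions are evaluated at $x_{T,i}$ using their restriction to $T$. The expression $\partial_{\mathbf{b}}w(\mathbf{b}_h)$ denotes the function $x\mapsto\partial_{\mathbf{b}}w(\mathbf{b}_h(x),x)$; it and $\mathbf{h}_s$ are understood to have well-defined values at the quadrature points. *)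

theory Defs
  imports "HOL-Analysis.Analysis"
begin

type_synonym space3 = "real^3"

text \<open>\<open>k\<close>-fold continuous differentiability on an open set, phrased through iterated directional
  derivatives so that the type of the function does not change along the recursion.\<close>

primrec Ck_on :: "nat \<Rightarrow> 'a::real_normed_vector set \<Rightarrow> ('a \<Rightarrow> 'b::real_normed_vector) \<Rightarrow> bool" where
  "Ck_on 0 S f \<longleftrightarrow> continuous_on S f"
| "Ck_on (Suc k) S f \<longleftrightarrow> (\<forall>x\<in>S. f differentiable (at x)) \<and>
     (\<forall>v. Ck_on k S (\<lambda>x. frechet_derivative f (at x) v))"

definition smooth_on :: "'a::real_normed_vector set \<Rightarrow> ('a \<Rightarrow> 'b::real_normed_vector) \<Rightarrow> bool" where
  "smooth_on S f \<longleftrightarrow> (\<forall>k. Ck_on k S f)"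

text \<open>Piecewise smoothness in the sense of Scholtes: a continuous function that is locally a
  selection from finitely many smooth functions. A continuous function that is smooth up to the
  boundary (i.e. has a smooth extension to a neighbourhood) on each cell of a locally finite
  partition of space is of this kind.\<close>

definition piecewise_smooth :: "('a::real_normed_vector \<Rightarrow> 'b::real_normed_vector) \<Rightarrow> bool" where
  "piecewise_smooth f \<longleftrightarrow> continuous_on UNIV f \<and>
     (\<forall>x. \<exists>U F. open U \<and> x \<in> U \<and> finite F \<and> (\<forall>g\<in>F. smooth_on U g) \<and>
       (\<forall>y\<in>U. \<exists>g\<in>F. f y = g y))"

definition gradient :: "('a::real_inner \<Rightarrow> real) \<Rightarrow> 'a \<Rightarrow> 'a" where
  "gradient f x = (THE D. GDERIV f x :> D)"

definition grad_b :: "(space3 \<Rightarrow> space3 \<Rightarrow> real) \<Rightarrow> space3 \<Rightarrow> space3 \<Rightarrow> space3" where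
  "grad_b w b x = gradient (\<lambda>b. w b x) b"

definition partial_deriv :: "3 \<Rightarrow> (space3 \<Rightarrow> real) \<Rightarrow> space3 \<Rightarrow> real" where
  "partial_deriv j f x = frechet_derivative f (at x) (axis j 1)"

definition curl :: "(space3 \<Rightarrow> space3) \<Rightarrow> space3 \<Rightarrow> space3" where
  "curl \<phi> x = vector
     [partial_deriv 2 (\<lambda>y. \<phi> y $ 3) x - partial_deriv 3 (\<lambda>y. \<phi> y $ 2) x,
      partial_deriv 3 (\<lambda>y. \<phi> y $ 1) x - partial_deriv 1 (\<lambda>y. \<phi> y $ 3) x,
      partial_deriv 1 (\<lambda>y. \<phi> y $ 2) x - partial_deriv 2 (\<lambda>y. \<phi> y $ 1) x]"

definition L2_on :: "space3 set \<Rightarrow> (space3 \<Rightarrow> space3) \<Rightarrow> bool" where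
  "L2_on \<Omega> f \<longleftrightarrow> set_borel_measurable lebesgue \<Omega> f \<and>
     set_integrable lebesgue \<Omega> (\<lambda>x. (norm (f x))\<^sup>2)"

definition test_field :: "space3 set \<Rightarrow> (space3 \<Rightarrow> space3) \<Rightarrow> bool" where
  "test_field \<Omega> \<phi> \<longleftrightarrow> smooth_on UNIV \<phi> \<and> (\<exists>K. compact K \<and> K \<subseteq> \<Omega> \<and> (\<forall>x. x \<notin> K \<longrightarrow> \<phi> x = 0))"

definition H_curl :: "space3 set \<Rightarrow> (space3 \<Rightarrow> space3) set" where
  "H_curl \<Omega> = {h. L2_on \<Omega> h \<and>
     (\<exists>c. L2_on \<Omega> c \<and>
       (\<forall>\<phi>. test_field \<Omega> \<phi> \<longrightarrow>
         (LINT x:\<Omega>|lebesgue. h x \<bullet> curl \<phi> x) = (LINT x:\<Omega>|lebesgue. c x \<bullet> \<phi> x)))}"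

text \<open>Near every boundary point, after a rotation taking \<open>e\<close> to the last coordinate direction,
  \<open>\<Omega>\<close> is the strict epigraph of a Lipschitz function \<open>g\<close> of the coordinates orthogonal to \<open>e\<close>.\<close>

definition lipschitz_domain :: "space3 set \<Rightarrow> bool" where
  "lipschitz_domain \<Omega> \<longleftrightarrow> open \<Omega> \<and> connected \<Omega> \<and> \<Omega> \<noteq> {} \<and>
     (\<forall>z\<in>frontier \<Omega>. \<exists>U e g C. open U \<and> z \<in> U \<and> norm e = 1 \<and>
        C-lipschitz_on {y. y \<bullet> e = 0} g \<and>
        \<Omega> \<inter> U = {x \<in> U. x \<bullet> e > g (x - (x \<bullet> e) *\<^sub>R e)})"

definition shape_regular :: "real \<Rightarrow> space3 set set \<Rightarrow> bool" where
  "shape_regular \<sigma> \<T> \<longleftrightarrow> (\<forall>T\<in>\<T>. \<exists>c r. r > 0 \<and> cball c r \<subseteq> T \<and> diameter T \<le> \<sigma> * r)"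

text \<open>The elements are closed tetrahedra; \<^const>\<open>triangulation\<close> contains finiteness and conformity
  (two elements meet in a common face, possibly empty).\<close>

definition tetrahedral_mesh :: "space3 set \<Rightarrow> space3 set set \<Rightarrow> bool" where
  "tetrahedral_mesh \<Omega> \<T> \<longleftrightarrow> triangulation \<T> \<and> (\<forall>T\<in>\<T>. 3 simplex T) \<and> \<Union>\<T> = closure \<Omega>"

definition poly_deg_le :: "nat \<Rightarrow> (space3 \<Rightarrow> real) \<Rightarrow> bool" where
  "poly_deg_le k q \<longleftrightarrow> (\<exists>c :: (3 \<Rightarrow> nat) \<Rightarrow> real. \<forall>x.
     q x = (\<Sum>\<alpha> | (\<Sum>i\<in>UNIV. \<alpha> i) \<le> k. c \<alpha> * (\<Prod>i\<in>UNIV. x $ i ^ \<alpha> i)))"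

lemma finite_multi_indices: "finite {\<alpha> :: 3 \<Rightarrow> nat. (\<Sum>i\<in>UNIV. \<alpha> i) \<le> k}"
proof (rule finite_subset)
  have "\<alpha> i \<le> k" if "(\<Sum>i\<in>UNIV. \<alpha> i) \<le> k" for \<alpha> :: "3 \<Rightarrow> nat" and i
    using member_le_sum[of i UNIV \<alpha>] that by auto
  then show "{\<alpha> :: 3 \<Rightarrow> nat. (\<Sum>i\<in>UNIV. \<alpha> i) \<le> k} \<subseteq> (\<Pi>\<^sub>E i\<in>UNIV. {..k})"
    by auto
  show "finite (\<Pi>\<^sub>E i\<in>(UNIV::3 set). {..k})"
    by (intro finite_PiE) auto
qed

text \<open>Elementwise (broken) vector fields are two-valued on faces shared by two elements. They are
  therefore represented by the family of their restrictions: \<open>b T x\<close> is the value at \<open>x \<in> T\<close> of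
  the restriction of \<open>b\<close> to the element \<open>T\<close>. Extensionality makes equality of such families the
  equality of the fields.\<close>

type_synonym broken_field = "space3 set \<Rightarrow> space3 \<Rightarrow> space3"

definition Q_space :: "space3 set set \<Rightarrow> nat \<Rightarrow> broken_field set" where
  "Q_space \<T> p = (\<Pi>\<^sub>E T\<in>\<T>. {restrict q T | q. \<forall>j. poly_deg_le (p - 1) (\<lambda>x. q x $ j)})"

definition V_space :: "space3 set \<Rightarrow> space3 set set \<Rightarrow> nat \<Rightarrow> (space3 \<Rightarrow> real) set" where
  "V_space \<Omega> \<T> p = {\<psi> \<in> extensional \<Omega>. continuous_on \<Omega> \<psi> \<and>
     (\<forall>T\<in>\<T>. \<exists>q. poly_deg_le p q \<and> (\<forall>x\<in>T \<inter> \<Omega>. \<psi> x = q x)) \<and>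
     (LINT x:\<Omega>|lebesgue. \<psi> x) = 0}"

text \<open>The polynomial that agrees with \<open>v\<close> on \<open>S\<close>; it is unique if \<open>S\<close> has interior points, as
  \<open>S = T \<inter> \<Omega>\<close> does for an element \<open>T\<close>.\<close>

definition elem_poly :: "space3 set \<Rightarrow> (space3 \<Rightarrow> real) \<Rightarrow> space3 \<Rightarrow> real" where
  "elem_poly S v = (THE q. real_polynomial_function q \<and> (\<forall>x\<in>S. v x = q x))"

definition broken_grad :: "space3 set \<Rightarrow> (space3 \<Rightarrow> real) \<Rightarrow> broken_field" where
  "broken_grad \<Omega> \<psi> T x = gradient (elem_poly (T \<inter> \<Omega>) \<psi>) x"

definition quadrature_rule ::
  "nat \<Rightarrow> space3 set \<Rightarrow> nat \<Rightarrow> (nat \<Rightarrow> space3) \<Rightarrow> (nat \<Rightarrow> real) \<Rightarrow> bool" where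
  "quadrature_rule k T n x \<omega> \<longleftrightarrow> (\<forall>i<n. x i \<in> T \<and> \<omega> i > 0) \<and>
     (\<forall>q. poly_deg_le k q \<longrightarrow> (\<Sum>i<n. \<omega> i * q (x i)) = (LINT y:T|lebesgue. q y))"

definition quad_prod ::
  "space3 set set \<Rightarrow> (space3 set \<Rightarrow> nat) \<Rightarrow> (space3 set \<Rightarrow> nat \<Rightarrow> space3) \<Rightarrow>
   (space3 set \<Rightarrow> nat \<Rightarrow> real) \<Rightarrow> broken_field \<Rightarrow> broken_field \<Rightarrow> real" where
  "quad_prod \<T> n x \<omega> a b = (\<Sum>T\<in>\<T>. \<Sum>i<n T. \<omega> T i * (a T (x T i) \<bullet> b T (x T i)))"

text \<open>The field \<open>x \<mapsto> \<partial>\<^sub>b w (b x, x)\<close> is given on \<open>\<Omega>\<close> only, whereas a quadrature point of \<open>T\<close> may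
  lie on the boundary of \<open>\<Omega>\<close>. Its value there is the limit from within the element.\<close>

definition material_field ::
  "(space3 \<Rightarrow> space3 \<Rightarrow> real) \<Rightarrow> space3 set \<Rightarrow> broken_field \<Rightarrow> broken_field" where
  "material_field w \<Omega> b T x =
     (if x \<in> \<Omega> then grad_b w (b T x) x
      else Lim (at x within T \<inter> \<Omega>) (\<lambda>y. grad_b w (b T y) y))"

definition material_field_defined_at ::
  "(space3 \<Rightarrow> space3 \<Rightarrow> real) \<Rightarrow> space3 set \<Rightarrow> broken_field \<Rightarrow> space3 set \<Rightarrow> space3 \<Rightarrow> bool" where
  "material_field_defined_at w \<Omega> b T x \<longleftrightarrow>
     x \<in> \<Omega> \<or> (\<exists>l. ((\<lambda>y. grad_b w (b T y) y) \<longlongrightarrow> l) (at x within T \<inter> \<Omega>))"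

end

theory Submission
  imports Defs "HOL-Library.Function_Algebras"
begin

text \<open>Exactness of the quadrature up to degree \<open>2p - 2\<close> makes \<open>\<langle>\<cdot>,\<cdot>\<rangle>\<^sub>h\<close> an inner product on the
  finite-dimensional space \<open>Q\<^sub>h\<close>, and \<open>\<nabla>V\<^sub>h \<subseteq> Q\<^sub>h\<close>. On the orthogonal complement of \<open>\<nabla>V\<^sub>h\<close> the first
  equation is strongly monotone and Lipschitz, so Zarantonello's fixed point argument determines
  \<open>b\<^sub>h\<close>; the residual is orthogonal to this complement and hence equals \<open>\<nabla>\<psi>\<^sub>h\<close> for some \<open>\<psi>\<^sub>h\<close>. The
  latter is unique because a function with vanishing elementwise gradient takes finitely many values
  and is therefore constant on the connected set \<open>\<Omega>\<close>.\<close>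

subsection \<open>Saddle point problems in finite-dimensional inner product spaces\<close>

text \<open>The obstacle is that the product depends on the mesh and the quadrature rule and is
  definite on polynomial fields only: a broken field that vanishes at all quadrature points has norm
  zero. Bilinearity on the whole space matters because the material field and
  \<open>h\<^sub>s\<close> need not be polynomial, yet are paired with elements of \<open>S\<close>;
  the Riesz theorem turns such functionals into elements of \<open>S\<close>. The second unknown is
  taken to be the gradient instead of the potential. It then ranges over a subspace \<open>G\<close>
  of \<open>S\<close> and is paired by the same \<open>ip\<close>, so orthogonality alone identifies
  it and no inf-sup estimate enters. Injectivity of the gradient on \<open>V_space\<close> leads
  back to the potential.\<close>

locale finite_dim_inner =
  fixes ip :: "'a::real_vector \<Rightarrow> 'a \<Rightarrow> real" and S :: "'a set"
  assumes linear_left: "linear (\<lambda>x. ip x y)"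
    and sym: "ip x y = ip y x"
    and nonneg: "0 \<le> ip x x"
    and definite: "\<lbrakk>x \<in> S; ip x x = 0\<rbrakk> \<Longrightarrow> x = 0"
    and subspace: "subspace S"
    and finite_span: "\<exists>B. finite B \<and> S \<subseteq> span B"
begin

lemma linear_right: "linear (ip x)"
  using linear_left[of x] by (simp add: sym[of _ x])

lemmas ip_simps = linear_add[OF linear_left] linear_add[OF linear_right]
  linear_diff[OF linear_left] linear_diff[OF linear_right]
  linear_scale[OF linear_left] linear_scale[OF linear_right]
  linear_0[OF linear_left] linear_0[OF linear_right]

lemma finite_dim_inner_subspace:
  assumes "M \<subseteq> S" "subspace M"
  shows "finite_dim_inner ip M"
proof (rule finite_dim_inner.intro)
  show "\<exists>B. finite B \<and> M \<subseteq> span B" using finite_span assms by blast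
qed (use assms definite in \<open>auto intro: linear_left nonneg sym\<close>)

text \<open>One step of Gram-Schmidt per induction step: subtracting from \<open>c\<close> its
  projection \<open>p\<close> onto \<open>span C\<close> leaves a vector \<open>d\<close> orthogonal
  to \<open>span C\<close>. The functional is kept arbitrary because the induction hypothesis serves
  twice, for \<open>\<phi>\<close> and, to obtain \<open>p\<close>, for \<open>ip c\<close>.\<close>

lemma riesz_span:
  assumes "finite C" "C \<subseteq> S" "linear \<phi>"
  shows "\<exists>r\<in>span C. \<forall>v\<in>span C. ip r v = \<phi> v"
  using assms
proof (induction C arbitrary: \<phi> rule: finite_induct)
  case empty
  then show ?case by (simp add: ip_simps linear_0)
next
  case (insert c C)
  have CS: "span C \<subseteq> S" using insert.prems subspace by (simp add: span_minimal)
  obtain r where r: "r \<in> span C" "\<And>v. v \<in> span C \<Longrightarrow> ip r v = \<phi> v"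
    using insert by blast
  obtain p where p: "p \<in> span C" "\<And>v. v \<in> span C \<Longrightarrow> ip p v = ip c v"
    using insert linear_right by blast
  define d where "d = c - p"
  have d: "ip d v = 0" "ip v d = 0" if "v \<in> span C" for v
    using p that by (auto simp: d_def ip_simps sym[of v])
  have dS: "d \<in> S" using CS p insert.prems subspace by (auto simp: d_def intro: subspace_diff)
  have d_in: "d \<in> span (insert c C)"
    unfolding d_def by (meson p(1) insertI1 span_base span_diff span_mono subset_insertI subsetD)
  show ?case
  proof (cases "d = 0")
    case True
    then have "span (insert c C) = span C" using p by (auto simp: d_def intro!: span_redundant)
    then show ?thesis using r by auto
  next
    case False
    then have pos: "ip d d \<noteq> 0" using definite dS by blast
    \<comment> \<open>The added multiple of \<open>d\<close> corrects the value at \<open>d\<close>;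
      orthogonality leaves the values on \<open>span C\<close> as they are.\<close>
    define s where "s = r + (\<phi> d / ip d d) *\<^sub>R d"
    have "ip s v = \<phi> v" if v: "v \<in> span (insert c C)" for v
    proof -
      obtain k where k: "v - k *\<^sub>R c \<in> span C" using v span_breakdown_eq[of v c C] by blast
      define u where "u = v - k *\<^sub>R d"
      have "u = (v - k *\<^sub>R c) + k *\<^sub>R p" by (simp add: u_def d_def algebra_simps)
      then have u: "u \<in> span C" using k p by (simp add: span_add span_scale)
      have v': "v = u + k *\<^sub>R d" by (simp add: u_def)
      show ?thesis
        unfolding v' s_def using u r d pos insert.prems(2) 
        by (simp add: ip_simps linear_add linear_scale)
    qed
    moreover have "s \<in> span (insert c C)"
      unfolding s_def using d_in r(1)
      by (meson span_add span_scale span_mono subset_insertI subsetD)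
    ultimately show ?thesis by blast
  qed
qed

lemma riesz:
  assumes "linear \<phi>"
  shows "\<exists>r\<in>S. \<forall>v\<in>S. ip r v = \<phi> v"
proof -
  obtain B where B: "finite B" "S \<subseteq> span B" using finite_span by blast
  \<comment> \<open>The spanning set \<open>B\<close> may lie outside \<open>S\<close>, so a basis
    inside \<open>S\<close> is chosen; its independence in \<open>span B\<close> makes it
    finite.\<close>
  obtain C where C: "C \<subseteq> S" "independent C" "S \<subseteq> span C"
    by (rule basis_exists)
  have "finite C" using independent_span_bound[OF B(1) C(2) subset_trans[OF C(1) B(2)]] by simp
  moreover have "span C = S" using C subspace by (meson span_minimal subset_antisym)
  ultimately show ?thesis using riesz_span[of C \<phi>] C(1) assms by metis
qed

section \<open>Induced norm, metric and completeness\<close>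

definition nrm :: "'a \<Rightarrow> real" where "nrm x = sqrt (ip x x)"

lemma nrm_nonneg: "nrm x \<ge> 0" by (simp add: nrm_def nonneg)

lemma nrm_sq: "(nrm x)\<^sup>2 = ip x x" by (simp add: nrm_def nonneg)

text \<open>The quadratic polynomial \<open>ip (x - t *\<^sub>R y) (x - t *\<^sub>R y)\<close> is
  nonnegative at its minimizer \<open>t\<close>. Only division by \<open>ip y y\<close> calls for
  definiteness, so \<open>x\<close> may be any vector of the type; the completeness proof uses this
  freedom.\<close>

lemma Cauchy_Schwarz:
  assumes "y \<in> S"
  shows "ip x y \<le> nrm x * nrm y"
proof (cases "y = 0")
  case False
  then have pos: "ip y y > 0" using definite[OF assms] nonneg[of y] by fastforce
  define t where "t = ip x y / ip y y"
  have "0 \<le> ip (x - t *\<^sub>R y) (x - t *\<^sub>R y)" by (rule nonneg)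
  also have "\<dots> = ip x x - (ip x y)\<^sup>2 / ip y y"
    using pos by (simp add: ip_simps t_def sym[of y x] field_simps power2_eq_square)
  finally have "(ip x y)\<^sup>2 \<le> (nrm x * nrm y)\<^sup>2"
    using pos by (simp add: power_mult_distrib nrm_sq field_simps)
  then show ?thesis
    by (rule power2_le_imp_le) (simp add: nrm_nonneg)
qed (simp add: nrm_def ip_simps)

lemma nrm_triangle:
  assumes "y \<in> S"
  shows "nrm (x + y) \<le> nrm x + nrm y"
proof (rule power2_le_imp_le)
  show "(nrm (x + y))\<^sup>2 \<le> (nrm x + nrm y)\<^sup>2"
    using Cauchy_Schwarz[OF assms, of x]
    by (simp add: power2_sum nrm_sq ip_simps sym[of y x])
qed (simp add: nrm_nonneg)

text \<open>The set-based notion of metric space is chosen so that Banach's fixed point theorem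
  applies to a carrier \<open>S\<close> inside a type without a norm of its own.\<close>

sublocale metric: Metric_space S "\<lambda>x y. nrm (x - y)"
proof
  fix x y z
  show "nrm (x - y) = nrm (y - x)" by (simp add: nrm_def ip_simps sym)
  assume *: "x \<in> S" "y \<in> S"
  then have "x - y \<in> S" using subspace subspace_diff by blast
  then show "nrm (x - y) = 0 \<longleftrightarrow> x = y"
    using definite[of "x - y"] by (auto simp: nrm_def ip_simps)
  assume "z \<in> S"
  then have "y - z \<in> S" using * subspace subspace_diff by blast
  from nrm_triangle[OF this, of "x - y"] show "nrm (x - z) \<le> nrm (x - y) + nrm (y - z)" by simp
qed (simp add: nrm_nonneg)

text \<open>Weak limits exist by the Riesz representation; for a Cauchy sequence they are strong limits.\<close>

lemma mcomplete: "metric.mcomplete"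
  unfolding metric.mcomplete_def
proof (intro allI impI)
  fix f assume f: "metric.MCauchy f"
  then have fS: "f n \<in> S" for n by (auto simp: metric.MCauchy_def)
  have dS: "x - y \<in> S" if "x \<in> S" "y \<in> S" for x y using that subspace subspace_diff by blast
  have Cau: "Cauchy (\<lambda>n. ip v (f n))" for v
  proof (rule metric_CauchyI)
    fix e :: real assume "e > 0"
    moreover have "nrm v + 1 > 0" using nrm_nonneg[of v] by linarith
    ultimately obtain N where N: "\<And>m n. m \<ge> N \<Longrightarrow> n \<ge> N \<Longrightarrow> nrm (f m - f n) < e / (nrm v + 1)"
      using f unfolding metric.MCauchy_def by (metis divide_pos_pos)
    have "dist (ip v (f m)) (ip v (f n)) < e" if "m \<ge> N" "n \<ge> N" for m n
    proof -
      have *: "ip v (f m - f n) < e" if "m \<ge> N" "n \<ge> N" for m n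
      proof -
        have "ip v (f m - f n) \<le> nrm v * nrm (f m - f n)" using Cauchy_Schwarz dS fS by blast
        also have "\<dots> \<le> nrm v * (e / (nrm v + 1))"
          using N[OF that] nrm_nonneg by (intro mult_left_mono) auto
        also have "\<dots> < e" using \<open>e > 0\<close> nrm_nonneg[of v] by (simp add: field_simps)
        finally show ?thesis .
      qed
      show ?thesis using *[OF that] *[OF that(2,1)] by (simp add: dist_real_def ip_simps)
    qed
    then show "\<exists>N. \<forall>m\<ge>N. \<forall>n\<ge>N. dist (ip v (f m)) (ip v (f n)) < e" by blast
  qed
  \<comment> \<open>The candidate for the weak limit. It is defined at every \<open>v\<close>, not
    only on \<open>S\<close>, since \<open>riesz\<close> takes a functional that is linear on the
    whole type.\<close>
  define \<phi> where "\<phi> v = lim (\<lambda>n. ip v (f n))" for v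
  have lim: "(\<lambda>n. ip v (f n)) \<longlonglongrightarrow> \<phi> v" for v
    using Cau[of v] unfolding \<phi>_def by (simp add: Cauchy_convergent_iff convergent_LIMSEQ_iff)
  have "linear \<phi>"
  proof
    show "\<phi> (u + v) = \<phi> u + \<phi> v" for u v
      using LIMSEQ_unique[OF lim[of "u + v"]] tendsto_add[OF lim[of u] lim[of v]] by (simp add: ip_simps)
    show "\<phi> (r *\<^sub>R v) = r *\<^sub>R \<phi> v" for r v
      using LIMSEQ_unique[OF lim[of "r *\<^sub>R v"]] tendsto_mult_left[OF lim[of v], of r] by (simp add: ip_simps)
  qed
  obtain l where l: "l \<in> S" "\<And>v. v \<in> S \<Longrightarrow> ip l v = \<phi> v" using riesz[OF \<open>linear \<phi>\<close>] by blast
  have "\<exists>N. \<forall>n\<ge>N. f n \<in> S \<and> nrm (f n - l) < e" if "e > 0" for e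
  proof -
    obtain N where N: "\<And>m n. m \<ge> N \<Longrightarrow> n \<ge> N \<Longrightarrow> nrm (f m - f n) < e / 2"
      using f \<open>e > 0\<close> unfolding metric.MCauchy_def by (metis half_gt_zero)
    have "nrm (f n - l) \<le> e / 2" if "n \<ge> N" for n
    proof -
      let ?d = "f n - l"
      have dSn: "?d \<in> S" using dS fS l by blast
      \<comment> \<open>The squared distance to \<open>l\<close> is a limit of products with the
        fixed vector \<open>?d\<close>, each at most \<open>nrm ?d * (e / 2)\<close>. Cancelling one
        factor \<open>nrm ?d\<close> gives the bound; \<open>e / 2\<close> in place of
        \<open>e\<close> absorbs the loss of strictness in the limit.\<close>
      have "(\<lambda>m. ip ?d (f n - f m)) \<longlonglongrightarrow> ip ?d (f n) - \<phi> ?d"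
        using tendsto_diff[OF tendsto_const lim[of ?d]] by (simp add: ip_simps)
      also have "ip ?d (f n) - \<phi> ?d = (nrm ?d)\<^sup>2"
        using l(2)[OF dSn] by (simp add: nrm_sq ip_simps sym[of l "f n"])
      finally have "(\<lambda>m. ip ?d (f n - f m)) \<longlonglongrightarrow> (nrm ?d)\<^sup>2" .
      moreover have "ip ?d (f n - f m) \<le> nrm ?d * (e / 2)" if "m \<ge> N" for m
        using Cauchy_Schwarz[OF dS[OF fS fS], of ?d n m] N[OF \<open>n \<ge> N\<close> that] nrm_nonneg[of ?d]
        by (smt (verit) mult_left_mono)
      ultimately have "(nrm ?d)\<^sup>2 \<le> nrm ?d * (e / 2)"
        by (intro LIMSEQ_le_const2[of _ "(nrm ?d)\<^sup>2"]) blast+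
      then show ?thesis using nrm_nonneg[of ?d] \<open>e > 0\<close>
        by (cases "nrm ?d = 0") (auto simp: power2_eq_square)
    qed
    then show ?thesis using fS \<open>e > 0\<close> by (smt (verit) field_sum_of_halves)
  qed
  then show "\<exists>x. limitin metric.mtopology f x sequentially"
    using l(1) by (auto simp: metric.limit_metric_sequentially)
qed

text \<open>Zarantonello's argument: for the Riesz representer \<open>R b\<close> of the residual, the map
  \<open>b \<mapsto> b - t R b\<close> with \<open>t = \<gamma> / K\<^sup>2\<close> contracts squared distances by \<open>1 - \<gamma>\<^sup>2 / K\<^sup>2\<close>.\<close>

lemma strongly_monotone_solvable:
  fixes a :: "'a \<Rightarrow> 'a \<Rightarrow> real"
  assumes lin: "\<And>b. linear (a b)" "linear l"
    and mono: "\<And>b b'. \<lbrakk>b \<in> S; b' \<in> S\<rbrakk> \<Longrightarrow> a b (b - b') - a b' (b - b') \<ge> \<gamma> * ip (b - b') (b - b')"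
    and lip: "\<And>b b' v. \<lbrakk>b \<in> S; b' \<in> S; v \<in> S\<rbrakk> \<Longrightarrow> a b v - a b' v \<le> L * nrm (b - b') * nrm v"
    and "\<gamma> > 0"
  shows "\<exists>b\<in>S. \<forall>v\<in>S. a b v = l v"
proof -
  \<comment> \<open>Monotonicity and the Lipschitz bound give \<open>\<gamma> \<le> L\<close> only
    when \<open>S\<close> contains a nonzero vector. The maximum keeps \<open>K\<close> positive and
    the radicand of \<open>k\<close> nonnegative in every case.\<close>
  define K where "K = max L \<gamma>"
  have K: "K > 0" "K \<ge> L" "K \<ge> \<gamma>" using \<open>\<gamma> > 0\<close> by (auto simp: K_def)
  have "\<exists>r\<in>S. \<forall>v\<in>S. ip r v = a b v - l v" for b
    by (rule riesz[OF linear_compose_sub[OF lin(1)[of b] lin(2)]])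
  then obtain R where R: "\<And>b. R b \<in> S" "\<And>b v. v \<in> S \<Longrightarrow> ip (R b) v = a b v - l v" by metis
  \<comment> \<open>This step size minimizes
    \<open>1 - 2 * t * \<gamma> + t\<^sup>2 * K\<^sup>2\<close>, the factor obtained by expanding
    the squared distance of two images; the minimum is \<open>k\<^sup>2\<close>.\<close>
  define t where "t = \<gamma> / K\<^sup>2"
  define k where "k = sqrt (1 - \<gamma>\<^sup>2 / K\<^sup>2)"
  have t: "t > 0" using K \<open>\<gamma> > 0\<close> by (simp add: t_def)
  have "\<gamma>\<^sup>2 \<le> K\<^sup>2" using K \<open>\<gamma> > 0\<close> by (simp add: power_mono)
  then have k: "k < 1" "k \<ge> 0" "k\<^sup>2 = 1 - \<gamma>\<^sup>2 / K\<^sup>2" using K \<open>\<gamma> > 0\<close> by (auto simp: k_def)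
  have tK: "t * K\<^sup>2 = \<gamma>" "k\<^sup>2 = 1 - t * \<gamma>"
    using K by (auto simp: k(3) t_def power2_eq_square[of \<gamma>])
  have contr: "nrm ((x - t *\<^sub>R R x) - (y - t *\<^sub>R R y)) \<le> k * nrm (x - y)" if xy: "x \<in> S" "y \<in> S" for x y
  proof -
    define d where "d = x - y"
    define r where "r = R x - R y"
    have dS: "d \<in> S" and rS: "r \<in> S" using xy R subspace by (auto simp: d_def r_def subspace_diff)
    have "(nrm r)\<^sup>2 = a x r - a y r" using R(2)[OF rS, of x] R(2)[OF rS, of y]
      by (simp add: nrm_sq) (simp add: r_def linear_diff[OF linear_left])
    also have "\<dots> \<le> L * nrm d * nrm r" using lip[OF xy rS] by (simp add: d_def)
    also have "\<dots> \<le> K * nrm d * nrm r" using K by (intro mult_right_mono) (auto simp: nrm_nonneg)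
    finally have "nrm r \<le> K * nrm d"
      using nrm_nonneg[of r] nrm_nonneg[of d] K by (cases "nrm r = 0") (auto simp: power2_eq_square)
    then have r: "(nrm r)\<^sup>2 \<le> K\<^sup>2 * (nrm d)\<^sup>2"
      using power_mono[OF _ nrm_nonneg, of r "K * nrm d" 2] by (simp add: power_mult_distrib)
    have "ip r d \<ge> \<gamma> * (nrm d)\<^sup>2"
      using mono[OF xy] R(2)[OF dS, of x] R(2)[OF dS, of y]
      by (simp add: nrm_sq r_def linear_diff[OF linear_left] flip: d_def)
    then have m: "2 * t * ip r d \<ge> 2 * t * (\<gamma> * (nrm d)\<^sup>2)" using t by (intro mult_left_mono) auto
    have "(nrm (d - t *\<^sub>R r))\<^sup>2 = (nrm d)\<^sup>2 - 2 * t * ip r d + t\<^sup>2 * (nrm r)\<^sup>2"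
      unfolding nrm_sq by (simp add: ip_simps sym[of d r] power2_eq_square algebra_simps)
    also have "\<dots> \<le> (nrm d)\<^sup>2 - 2 * t * (\<gamma> * (nrm d)\<^sup>2) + t\<^sup>2 * (K\<^sup>2 * (nrm d)\<^sup>2)"
      using m mult_left_mono[OF r, of "t\<^sup>2"] by simp
    also have "\<dots> = (1 - 2 * (t * \<gamma>) + t * (t * K\<^sup>2)) * (nrm d)\<^sup>2"
      by (simp add: power2_eq_square[of t] algebra_simps)
    also have "\<dots> = k\<^sup>2 * (nrm d)\<^sup>2"
      using tK by simp
    finally have "(nrm (d - t *\<^sub>R r))\<^sup>2 \<le> (k * nrm d)\<^sup>2" by (simp add: power_mult_distrib)
    then have "nrm (d - t *\<^sub>R r) \<le> k * nrm d" by (rule power2_le_imp_le) (simp add: k nrm_nonneg)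
    moreover have "d - t *\<^sub>R r = (x - t *\<^sub>R R x) - (y - t *\<^sub>R R y)"
      by (simp add: d_def r_def algebra_simps)
    ultimately show ?thesis by (simp only: flip: d_def)
  qed
  define F where "F b = b - t *\<^sub>R R b" for b
  have "F \<in> S \<rightarrow> S" using R(1) subspace by (simp add: F_def subspace_diff subspace_scale)
  moreover have "S \<noteq> {}" using subspace subspace_0 by blast
  moreover have "nrm (F x - F y) \<le> k * nrm (x - y)" if "x \<in> S" "y \<in> S" for x y
    using contr[OF that] by (simp only: F_def)
  ultimately obtain b where b: "b \<in> S" "F b = b"
    by (metis metric.Banach_fixedpoint_thm[OF mcomplete _ _ k(1)])
  then have "R b = 0" using t by (simp add: F_def)
  then show ?thesis using b(1) R(2)[of _ b] by (intro bexI[of _ b]) (auto simp: ip_simps)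
qed

text \<open>For uniqueness, the difference of two solutions \<open>b1\<close>, \<open>b2\<close> is
  orthogonal to \<open>G\<close>, so testing with it removes the multipliers and leaves strong
  monotonicity. Once \<open>b1 = b2\<close>, testing with \<open>g1 - g2\<close>, which belongs to
  \<open>S\<close>, settles the multipliers.\<close>

theorem saddle_point_unique:
  fixes a :: "'a \<Rightarrow> 'a \<Rightarrow> real"
  assumes G: "subspace G" "G \<subseteq> S"
    and lin: "\<And>b. linear (a b)" "linear l"
    and mono: "\<And>b b'. \<lbrakk>b \<in> S; b' \<in> S\<rbrakk> \<Longrightarrow> a b (b - b') - a b' (b - b') \<ge> \<gamma> * ip (b - b') (b - b')"
    and lip: "\<And>b b' v. \<lbrakk>b \<in> S; b' \<in> S; v \<in> S\<rbrakk> \<Longrightarrow> a b v - a b' v \<le> L * nrm (b - b') * nrm v"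
    and "\<gamma> > 0"
  shows "\<exists>!(b, g). b \<in> S \<and> g \<in> G \<and> (\<forall>v\<in>S. a b v + ip g v = l v) \<and> (\<forall>v\<in>G. ip b v = 0)"
proof -
  define M where "M = {b \<in> S. \<forall>v\<in>G. ip b v = 0}"
  have "subspace M"
    using subspace by (auto simp: M_def subspace_def ip_simps)
  then interpret M: finite_dim_inner ip M
    by (intro finite_dim_inner_subspace) (auto simp: M_def)
  interpret G: finite_dim_inner ip G
    using G by (intro finite_dim_inner_subspace) auto
  have "M.nrm = nrm" by (auto simp: fun_eq_iff M.nrm_def nrm_def)
  then have "\<exists>b\<in>M. \<forall>v\<in>M. a b v = l v"
    using lin mono lip \<open>\<gamma> > 0\<close> by (intro M.strongly_monotone_solvable[of a l \<gamma> L]) (auto simp: M_def)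
  then obtain b where b: "b \<in> M" "\<And>v. v \<in> M \<Longrightarrow> a b v = l v" by blast
  obtain r where r: "r \<in> S" "\<And>v. v \<in> S \<Longrightarrow> ip r v = l v - a b v"
    using riesz[OF linear_compose_sub[OF lin(2) lin(1)[of b]]] by blast
  \<comment> \<open>The orthogonal projection of \<open>r\<close> onto \<open>G\<close>. The
    remainder \<open>r - g\<close> lies in \<open>M\<close>; there \<open>r\<close> acts as zero
    because \<open>b\<close> solves the equation on \<open>M\<close>, and \<open>g\<close> because
    it belongs to \<open>G\<close>. Hence the remainder has norm zero.\<close>
  obtain g where g: "g \<in> G" "\<And>v. v \<in> G \<Longrightarrow> ip g v = ip r v"
    using G.riesz[OF linear_right[of r]] by blast
  have m: "r - g \<in> M"
    using r(1) g G subspace by (auto simp: M_def ip_simps subspace_diff)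
  have "ip (r - g) (r - g) = ip r (r - g) - ip g (r - g)" by (simp add: ip_simps)
  also have "ip g (r - g) = 0" using m g(1) sym[of g "r - g"] by (simp add: M_def)
  also have "ip r (r - g) = 0" using m b(2) r(2) by (auto simp: M_def)
  finally have "r = g" using M.definite m by force
  then have ex: "a b v + ip g v = l v" if "v \<in> S" for v using r that by simp
  have uniq: "b1 = b2 \<and> g1 = g2"
    if 1: "b1 \<in> S" "g1 \<in> G" "\<And>v. v \<in> S \<Longrightarrow> a b1 v + ip g1 v = l v" "\<And>v. v \<in> G \<Longrightarrow> ip b1 v = 0"
    and 2: "b2 \<in> S" "g2 \<in> G" "\<And>v. v \<in> S \<Longrightarrow> a b2 v + ip g2 v = l v" "\<And>v. v \<in> G \<Longrightarrow> ip b2 v = 0"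
    for b1 g1 b2 g2
  proof -
    define d where "d = b1 - b2"
    have dS: "d \<in> S" using 1 2 subspace by (simp add: d_def subspace_diff)
    have "\<gamma> * ip d d \<le> a b1 d - a b2 d" using mono 1 2 by (simp add: d_def)
    also have "\<dots> = ip g2 d - ip g1 d" using 1(3)[OF dS] 2(3)[OF dS] by simp
    also have "\<dots> = 0" using 1(2,4) 2(2,4)
      by (simp add: d_def ip_simps sym[of g1] sym[of g2])
    finally have "ip d d = 0" using \<open>\<gamma> > 0\<close> nonneg[of d] by (simp add: mult_le_0_iff)
    then have b: "b1 = b2" using definite[OF dS] by (simp add: d_def)
    have gS: "g1 - g2 \<in> S" using 1 2 G subspace by (meson subspace_diff subsetD)
    have "ip (g1 - g2) (g1 - g2) = 0" using 1(3)[OF gS] 2(3)[OF gS] b by (simp add: ip_simps)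
    then show ?thesis using b definite[OF gS] by simp
  qed
  show ?thesis
  proof (rule ex1I[of _ "(b, g)"])
    show "case (b, g) of (b, g) \<Rightarrow> b \<in> S \<and> g \<in> G \<and> (\<forall>v\<in>S. a b v + ip g v = l v) \<and> (\<forall>v\<in>G. ip b v = 0)"
      using b g ex by (auto simp: M_def)
    show "bg = (b, g)"
      if "case bg of (b, g) \<Rightarrow> b \<in> S \<and> g \<in> G \<and> (\<forall>v\<in>S. a b v + ip g v = l v) \<and> (\<forall>v\<in>G. ip b v = 0)" for bg
      using that uniq[of "fst bg" "snd bg" b g] b g ex by (cases bg) (auto simp: M_def)
  qed
qed

end

subsection \<open>Polynomials of bounded degree\<close>

text \<open>On the line from a point \<open>a\<close> of \<open>U\<close> to \<open>x\<close> the
  function is a univariate polynomial with infinitely many roots near \<open>a\<close>, hence zero;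
  the parameter value 1 corresponds to \<open>x\<close>.\<close>

lemma real_polynomial_function_zero_on_open:
  fixes q :: "'a::real_normed_vector \<Rightarrow> real"
  assumes q: "real_polynomial_function q" and U: "open U" "U \<noteq> {}" and zero: "\<And>x. x \<in> U \<Longrightarrow> q x = 0"
  shows "q x = 0"
proof -
  obtain a where a: "a \<in> U" using U by blast
  then obtain e where e: "e > 0" "ball a e \<subseteq> U" using U(1) by (meson open_contains_ball)
  define f where "f t = a + t *\<^sub>R (x - a)" for t :: real
  have "polynomial_function f"
    unfolding f_def
    by (intro polynomial_function_add polynomial_function_const polynomial_function_bounded_linear
        bounded_linear_scaleR_left)
  then have "real_polynomial_function (q \<circ> f)" using q by (rule real_polynomial_function_compose)
  then obtain c N where c: "q \<circ> f = (\<lambda>t. \<Sum>i\<le>N. c i * t ^ i)"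
    using real_polynomial_function_iff_sum by blast
  define d where "d = e / (norm (x - a) + 1)"
  have np: "norm (x - a) + 1 > 0" using norm_ge_zero[of "x - a"] by linarith
  have d: "d > 0" using e np by (simp add: d_def)
  have "{0<..<d} \<subseteq> {t. (\<Sum>i\<le>N. c i * t ^ i) = 0}"
  proof
    fix t assume t: "t \<in> {0<..<d}"
    then have "t * norm (x - a) \<le> t * (norm (x - a) + 1)" by (simp add: algebra_simps)
    also have "\<dots> < e" using t np by (simp add: d_def field_simps)
    finally have "f t \<in> ball a e" using t by (simp add: f_def dist_norm)
    then have "(q \<circ> f) t = 0" using e zero by auto
    then show "t \<in> {t. (\<Sum>i\<le>N. c i * t ^ i) = 0}" by (simp add: c)
  qed
  then have "infinite {t. (\<Sum>i\<le>N. c i * t ^ i) = 0}"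
    using d infinite_Ioo finite_subset by blast
  then have "\<And>i. i \<le> N \<Longrightarrow> c i = 0" using polyfun_finite_roots[of c N] by auto
  then have "(q \<circ> f) 1 = 0" by (simp add: c)
  then show ?thesis by (simp add: f_def)
qed

lemma real_polynomial_function_eq_on_open:
  fixes q r :: "'a::real_normed_vector \<Rightarrow> real"
  assumes "real_polynomial_function q" "real_polynomial_function r"
    and "open U" "U \<noteq> {}" "\<And>x. x \<in> U \<Longrightarrow> q x = r x"
  shows "q = r"
  using real_polynomial_function_zero_on_open[of "\<lambda>x. q x - r x" U] assms
  by (auto simp: fun_eq_iff)

lemma gradient_eq:
  assumes "GDERIV f x :> D"
  shows "gradient f x = D"
  unfolding gradient_def
proof (rule the_equality)
  fix D' assume "GDERIV f x :> D'"
  then have "(\<lambda>h. h \<bullet> D') = (\<lambda>h. h \<bullet> D)"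
    using assms has_derivative_unique unfolding gderiv_def by blast
  then show "D' = D" by (metis vector_eq_ldot)
qed (rule assms)

section \<open>Monomials and degree bounds\<close>

definition monomial :: "(3 \<Rightarrow> nat) \<Rightarrow> space3 \<Rightarrow> real" where
  "monomial \<alpha> x = (\<Prod>i\<in>UNIV. x $ i ^ \<alpha> i)"

lemma poly_deg_le_iff:
  "poly_deg_le k q \<longleftrightarrow> (\<exists>c. q = (\<lambda>x. \<Sum>\<alpha> | sum \<alpha> UNIV \<le> k. c \<alpha> * monomial \<alpha> x))"
  by (simp add: poly_deg_le_def monomial_def fun_eq_iff)

lemma poly_deg_le_monomial:
  assumes "sum \<alpha> UNIV \<le> k"
  shows "poly_deg_le k (monomial \<alpha>)"
proof -
  have "monomial \<alpha> x = (\<Sum>\<beta> | sum \<beta> UNIV \<le> k. (if \<beta> = \<alpha> then 1 else 0) * monomial \<beta> x)" for x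
    using assms finite_multi_indices[of k] by (simp add: if_distrib[of "\<lambda>y. y * _"] sum.delta cong: if_cong)
  then show ?thesis
    unfolding poly_deg_le_iff by (intro exI[of _ "\<lambda>\<beta>. if \<beta> = \<alpha> then 1 else 0"] ext)
qed

lemma poly_deg_le_add:
  assumes "poly_deg_le k f" "poly_deg_le k g"
  shows "poly_deg_le k (\<lambda>x. f x + g x)"
proof -
  obtain c d where "f = (\<lambda>x. \<Sum>\<alpha> | sum \<alpha> UNIV \<le> k. c \<alpha> * monomial \<alpha> x)"
    "g = (\<lambda>x. \<Sum>\<alpha> | sum \<alpha> UNIV \<le> k. d \<alpha> * monomial \<alpha> x)"
    using assms unfolding poly_deg_le_iff by blast
  then have "(\<lambda>x. f x + g x) = (\<lambda>x. \<Sum>\<alpha> | sum \<alpha> UNIV \<le> k. (c \<alpha> + d \<alpha>) * monomial \<alpha> x)"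
    by (simp add: sum.distrib distrib_right)
  then show ?thesis unfolding poly_deg_le_iff by (rule exI[of _ "\<lambda>\<alpha>. c \<alpha> + d \<alpha>"])
qed

lemma poly_deg_le_cmult:
  assumes "poly_deg_le k f"
  shows "poly_deg_le k (\<lambda>x. r * f x)"
proof -
  obtain c where "f = (\<lambda>x. \<Sum>\<alpha> | sum \<alpha> UNIV \<le> k. c \<alpha> * monomial \<alpha> x)"
    using assms unfolding poly_deg_le_iff by blast
  then have "(\<lambda>x. r * f x) = (\<lambda>x. \<Sum>\<alpha> | sum \<alpha> UNIV \<le> k. (r * c \<alpha>) * monomial \<alpha> x)"
    by (simp add: sum_distrib_left mult.assoc)
  then show ?thesis unfolding poly_deg_le_iff by (rule exI[of _ "\<lambda>\<alpha>. r * c \<alpha>"])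
qed

lemma poly_deg_le_0: "poly_deg_le k (\<lambda>x. 0)"
  unfolding poly_deg_le_iff by (rule exI[of _ "\<lambda>_. 0"]) simp

lemma poly_deg_le_sum:
  "(\<And>i. i \<in> I \<Longrightarrow> poly_deg_le k (f i)) \<Longrightarrow> poly_deg_le k (\<lambda>x. \<Sum>i\<in>I. f i x)"
  by (induction I rule: infinite_finite_induct) (auto intro: poly_deg_le_0 poly_deg_le_add)

text \<open>Replaces computation with coefficient families: a property that respects linear
  combinations, such as a degree bound for products or gradients, has to be checked on monomials
  only.\<close>

lemma poly_deg_le_induct [consumes 1, case_names zero add cmult monomial]:
  assumes "poly_deg_le k q"
    and zero: "P (\<lambda>x. 0)"
    and add: "\<And>f g. P f \<Longrightarrow> P g \<Longrightarrow> P (\<lambda>x. f x + g x)"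
    and cmult: "\<And>r f. P f \<Longrightarrow> P (\<lambda>x. r * f x)"
    and mono: "\<And>\<alpha>. sum \<alpha> UNIV \<le> k \<Longrightarrow> P (monomial \<alpha>)"
  shows "P q"
proof -
  obtain c where q: "q = (\<lambda>x. \<Sum>\<alpha> | sum \<alpha> UNIV \<le> k. c \<alpha> * monomial \<alpha> x)"
    using assms(1) unfolding poly_deg_le_iff by blast
  have "P (\<lambda>x. \<Sum>\<alpha>\<in>I. c \<alpha> * monomial \<alpha> x)" if "finite I" "I \<subseteq> {\<alpha>. sum \<alpha> UNIV \<le> k}" for I
    using that
  proof (induction I rule: finite_induct)
    case (insert \<alpha> I)
    then show ?case using add[OF cmult[OF mono[of \<alpha>]], of _ "c \<alpha>"] by simp
  qed (simp add: zero)
  then show ?thesis unfolding q using finite_multi_indices[of k] by simp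
qed

lemma monomial_mult: "monomial \<alpha> x * monomial \<beta> x = monomial (\<lambda>i. \<alpha> i + \<beta> i) x"
  by (simp add: monomial_def power_add prod.distrib)

lemma poly_deg_le_mult:
  assumes f: "poly_deg_le j f" and g: "poly_deg_le k g"
  shows "poly_deg_le (j + k) (\<lambda>x. f x * g x)"
  using f
proof (induction f rule: poly_deg_le_induct)
  case (monomial \<alpha>)
  show ?case using g
  proof (induction g rule: poly_deg_le_induct)
    case (monomial \<beta>)
    then show ?case using \<open>sum \<alpha> UNIV \<le> j\<close> unfolding monomial_mult
      by (intro poly_deg_le_monomial) (simp add: sum.distrib)
  qed (simp_all add: distrib_left mult.left_commute poly_deg_le_0 poly_deg_le_add poly_deg_le_cmult)
qed (simp_all add: distrib_right mult.assoc poly_deg_le_0 poly_deg_le_add poly_deg_le_cmult)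

lemma poly_deg_le_imp_real_polynomial_function:
  assumes "poly_deg_le k q"
  shows "real_polynomial_function q"
  using assms
proof (induction q rule: poly_deg_le_induct)
  case (monomial \<alpha>)
  have "real_polynomial_function (\<lambda>x::space3. x $ i)" for i
    by (intro real_polynomial_function.intros(1) bounded_linear_vec_nth)
  then have "real_polynomial_function (\<lambda>x::space3. \<Prod>i\<in>UNIV. x $ i ^ \<alpha> i)"
    by (intro real_polynomial_function_prod real_polynomial_function_power) auto
  then show ?case by (simp add: monomial_def[abs_def])
qed auto

text \<open>Truncated subtraction in the exponent is harmless: where \<open>\<alpha> i = 0\<close>,
  the factor \<open>real (\<alpha> i)\<close> is zero.\<close>

lemma GDERIV_monomial:
  "GDERIV (monomial \<alpha>) x :> (\<chi> i. real (\<alpha> i) * monomial (\<alpha>(i := \<alpha> i - 1)) x)"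
proof -
  have "((\<lambda>x. \<Prod>i\<in>UNIV. x $ i ^ \<alpha> i) has_derivative
      (\<lambda>h. \<Sum>i\<in>UNIV. (real (\<alpha> i) * (h $ i * x $ i ^ (\<alpha> i - 1))) * (\<Prod>j\<in>UNIV - {i}. x $ j ^ \<alpha> j))) (at x)"
    by (intro has_derivative_prod)
      (auto intro!: derivative_eq_intros bounded_linear_imp_has_derivative simp: mult_ac bounded_linear_vec_nth)
  also have "(\<lambda>h. \<Sum>i\<in>UNIV. (real (\<alpha> i) * (h $ i * x $ i ^ (\<alpha> i - 1))) * (\<Prod>j\<in>UNIV - {i}. x $ j ^ \<alpha> j)) =
      (\<lambda>h. h \<bullet> (\<chi> i. real (\<alpha> i) * monomial (\<alpha>(i := \<alpha> i - 1)) x))"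
  proof
    fix h :: space3
    have "monomial (\<alpha>(i := \<alpha> i - 1)) x = x $ i ^ (\<alpha> i - 1) * (\<Prod>j\<in>UNIV - {i}. x $ j ^ \<alpha> j)" for i
      unfolding monomial_def by (subst prod.remove[of _ i]) (auto intro!: prod.cong)
    then show "(\<Sum>i\<in>UNIV. (real (\<alpha> i) * (h $ i * x $ i ^ (\<alpha> i - 1))) * (\<Prod>j\<in>UNIV - {i}. x $ j ^ \<alpha> j)) =
      h \<bullet> (\<chi> i. real (\<alpha> i) * monomial (\<alpha>(i := \<alpha> i - 1)) x)"
      by (simp add: inner_vec_def mult_ac)
  qed
  finally show ?thesis by (simp add: gderiv_def monomial_def[abs_def])
qed

text \<open>The source of the inclusion of the gradients of \<open>V_space\<close> in the polynomial
  fields of degree \<open>p - 1\<close>.\<close>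

lemma poly_deg_le_GDERIV:
  assumes "poly_deg_le k q"
  obtains D where "\<And>x. GDERIV q x :> D x" "\<And>i. poly_deg_le (k - 1) (\<lambda>x. D x $ i)"
proof -
  have "\<exists>D. (\<forall>x. GDERIV q x :> D x) \<and> (\<forall>i. poly_deg_le (k - 1) (\<lambda>x. D x $ i))"
    using assms
  proof (induction q rule: poly_deg_le_induct)
    case zero
    show ?case by (rule exI[of _ "\<lambda>x. 0"]) (auto simp: poly_deg_le_0 intro: GDERIV_const)
  next
    case (add f g)
    then obtain D E where "\<And>x. GDERIV f x :> D x" "\<And>i. poly_deg_le (k - 1) (\<lambda>x. D x $ i)"
      "\<And>x. GDERIV g x :> E x" "\<And>i. poly_deg_le (k - 1) (\<lambda>x. E x $ i)" by auto
    then show ?case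
      by (intro exI[of _ "\<lambda>x. D x + E x"]) (auto intro: GDERIV_add poly_deg_le_add)
  next
    case (cmult r f)
    then obtain D where D: "\<And>x. GDERIV f x :> D x" "\<And>i. poly_deg_le (k - 1) (\<lambda>x. D x $ i)"
      by auto
    have "GDERIV (\<lambda>x. r * f x) x :> r *\<^sub>R D x" for x
      using GDERIV_mult[OF GDERIV_const[of r x] D(1)[of x]] by simp
    then show ?case
      using D(2) by (intro exI[of _ "\<lambda>x. r *\<^sub>R D x"]) (auto intro: poly_deg_le_cmult)
  next
    case (monomial \<alpha>)
    have "poly_deg_le (k - 1) (\<lambda>x. real (\<alpha> i) * monomial (\<alpha>(i := \<alpha> i - 1)) x)" for i
    proof (cases "\<alpha> i = 0")
      case False
      have "sum (\<alpha>(i := \<alpha> i - 1)) UNIV + 1 = sum \<alpha> UNIV"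
        using False by (simp add: sum.remove[of UNIV i])
      then show ?thesis
        using monomial by (intro poly_deg_le_cmult poly_deg_le_monomial) linarith
    qed (simp add: poly_deg_le_0)
    then show ?case using GDERIV_monomial by (intro exI[of _ "\<lambda>x. \<chi> i. real (\<alpha> i) * monomial (\<alpha>(i := \<alpha> i - 1)) x"]) auto
  qed
  then show ?thesis using that by blast
qed

text \<open>Two polynomials that agree on a set with interior points coincide, so the definite
  description is determined by any polynomial matching \<open>v\<close> on \<open>S\<close>.\<close>

lemma elem_poly_eq:
  assumes "real_polynomial_function q" "\<And>x. x \<in> S \<Longrightarrow> v x = q x" "interior S \<noteq> {}"
  shows "elem_poly S v = q"
  unfolding elem_poly_def
proof (rule the_equality)
  fix r assume r: "real_polynomial_function r \<and> (\<forall>x\<in>S. v x = r x)"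
  have "r x = q x" if "x \<in> interior S" for x
    using r assms(2) that interior_subset by (metis subsetD)
  then show "r = q"
    using real_polynomial_function_eq_on_open[of r q "interior S"] r assms(1,3) by auto
qed (use assms in auto)

lemma GDERIV_zero_imp_const:
  assumes "\<And>x. GDERIV f x :> 0"
  shows "f x = f y"
proof -
  have "\<exists>c. \<forall>x\<in>UNIV. f x = c"
    using assms by (intro has_derivative_zero_constant) (auto simp: gderiv_def)
  then show ?thesis by auto
qed

subsection \<open>Quadrature and the finite element spaces\<close>

lemma full_simplex_properties:
  fixes T :: "space3 set"
  assumes "3 simplex T"
  shows "convex T" "compact T" "interior T \<noteq> {}"
proof -
  obtain C where C: "finite C" "T = convex hull C" using assms by (auto simp: simplex)
  show conv: "convex T" and "compact T" using C by (auto simp: finite_imp_compact_convex_hull)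
  have dim: "aff_dim T = 3" using assms aff_dim_simplex by blast
  then have "affine hull T = UNIV" using aff_dim_eq_full[of T] by simp
  then have "interior T = rel_interior T" by (simp add: rel_interior_interior)
  moreover have "T \<noteq> {}" using dim by auto
  ultimately show "interior T \<noteq> {}" using rel_interior_eq_empty conv by auto
qed

text \<open>An open set that meets the closure of \<open>\<Omega>\<close> meets
  \<open>\<Omega>\<close>. This ensures that the restriction to \<open>T \<inter> \<Omega>\<close>
  determines the polynomial on an element.\<close>

lemma interior_Int_open_nonempty:
  assumes "open \<Omega>" "T \<subseteq> closure \<Omega>" "interior T \<noteq> {}"
  shows "interior (T \<inter> \<Omega>) \<noteq> {}"
proof -
  have "interior T \<inter> closure \<Omega> \<noteq> {}" using assms(2,3) interior_subset by blast
  then show ?thesis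
    using open_Int_closure_eq_empty[of "interior T" \<Omega>] assms(1) by (simp add: interior_open)
qed

text \<open>A convex set with interior points lies in the closure of its interior, and
  \<open>interior T \<inter> \<Omega>\<close> is dense in that interior. A closure point of an open
  set in Euclidean space is a limit point of it. Limits from within the element are thereby unique,
  also at points of the boundary of \<open>\<Omega>\<close>.\<close>

lemma islimpt_Int_open:
  fixes T :: "'a::euclidean_space set"
  assumes "convex T" "interior T \<noteq> {}" "open \<Omega>" "T \<subseteq> closure \<Omega>" "x \<in> T"
  shows "x islimpt (T \<inter> \<Omega>)"
proof -
  define U where "U = interior T \<inter> \<Omega>"
  have U: "open U" "U \<subseteq> T \<inter> \<Omega>" using assms interior_subset[of T] by (auto simp: U_def)
  have "interior T \<subseteq> closure U"
    using open_Int_closure_subset[of "interior T" \<Omega>] assms(4) interior_subset[of T]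
    by (auto simp: U_def)
  then have "closure (interior T) \<subseteq> closure U" by (simp add: closure_minimal)
  moreover have "x \<in> closure (interior T)"
    using convex_closure_interior[OF assms(1,2)] closure_subset assms(5) by blast
  ultimately have "x \<in> closure U" by blast
  then have "x islimpt U"
    using U(1) interior_limit_point[of x U] by (auto simp: closure_def interior_open)
  then show ?thesis using U(2) islimpt_subset by blast
qed

text \<open>A nonnegative function with zero integral vanishes almost everywhere. By continuity its
  nonzero points in the interior form an open set, and an open negligible set is empty.\<close>

lemma set_integral_zero_imp_zero_interior:
  fixes f :: "'a::euclidean_space \<Rightarrow> real"
  assumes T: "compact T" and f: "continuous_on T f" "\<And>x. x \<in> T \<Longrightarrow> f x \<ge> 0"
    and int: "(LINT x:T|lebesgue. f x) = 0" and x: "x \<in> interior T"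
  shows "f x = 0"
proof -
  let ?g = "\<lambda>x. indicator T x *\<^sub>R f x"
  have "integrable lborel ?g" using T f(1) by (rule borel_integrable_compact)
  then have "integrable lebesgue ?g" by (simp add: integrable_completion)
  moreover have "AE x in lebesgue. 0 \<le> ?g x" using f(2) by (auto simp: indicator_def)
  ultimately have "AE x in lebesgue. ?g x = 0"
    using int by (simp add: integral_nonneg_eq_0_iff_AE set_lebesgue_integral_def)
  then have "{x. ?g x \<noteq> 0} \<in> null_sets lebesgue" by (simp add: AE_iff_null_sets completion.AE_iff_null_sets)
  then have "negligible {x. ?g x \<noteq> 0}" by (simp add: negligible_iff_null_sets)
  moreover have "{x \<in> interior T. f x \<noteq> 0} \<subseteq> {x. ?g x \<noteq> 0}" using interior_subset[of T] by auto
  ultimately have "negligible {x \<in> interior T. f x \<noteq> 0}" by (rule negligible_subset)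
  moreover have "open {x \<in> interior T. f x \<noteq> 0}"
  proof -
    have "continuous_on (interior T) f" using f(1) continuous_on_subset interior_subset by blast
    then have "open (interior T \<inter> f -` (- {0}))"
      by (intro continuous_open_preimage) auto
    then show ?thesis by (simp add: vimage_def Int_def)
  qed
  ultimately show ?thesis using open_not_negligible x by blast
qed

lemma real_polynomial_function_continuous_on:
  assumes "real_polynomial_function q"
  shows "continuous_on S q"
  using assms by (simp add: real_polynomial_function_eq continuous_on_polymonial_function)

text \<open>The square of a field of degree \<open>k\<close> has degree \<open>k + k\<close>, so the
  vanishing quadrature sum is the exact integral. The square is then zero on the interior of
  \<open>T\<close> and, being a polynomial, everywhere.\<close>

lemma quadrature_definite:
  assumes quad: "quadrature_rule (k + k) T n x \<omega>" and T: "compact T" "interior T \<noteq> {}"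
    and q: "\<And>j. poly_deg_le k (\<lambda>x. q x $ j)"
    and zero: "(\<Sum>i<n. \<omega> i * (q (x i) \<bullet> q (x i))) = 0"
  shows "q = (\<lambda>x. 0)"
proof -
  have p: "poly_deg_le (k + k) (\<lambda>x. q x \<bullet> q x)"
    unfolding inner_vec_def inner_real_def by (intro poly_deg_le_sum poly_deg_le_mult q)
  then have rp: "real_polynomial_function (\<lambda>x. q x \<bullet> q x)"
    by (rule poly_deg_le_imp_real_polynomial_function)
  have "(LINT y:T|lebesgue. q y \<bullet> q y) = (\<Sum>i<n. \<omega> i * (q (x i) \<bullet> q (x i)))"
    using conjunct2[OF quad[unfolded quadrature_rule_def], THEN spec, of "\<lambda>x. q x \<bullet> q x"] p
    by (simp only:)
  then have "(LINT y:T|lebesgue. q y \<bullet> q y) = 0" using zero by simp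
  then have "q y \<bullet> q y = 0" if "y \<in> interior T" for y
    by (rule set_integral_zero_imp_zero_interior
        [OF T(1) real_polynomial_function_continuous_on[OF rp] inner_ge_zero _ that])
  then have "q y \<bullet> q y = 0" for y
    by (rule real_polynomial_function_zero_on_open[OF rp open_interior T(2)])
  then show ?thesis by auto
qed

section \<open>The continuous finite element space and its elementwise gradient\<close>

locale mesh =
  fixes \<Omega> :: "space3 set" and \<T> :: "space3 set set" and p :: nat
  assumes bounded: "bounded \<Omega>" and open_domain: "open \<Omega>" and connected: "connected \<Omega>"
    and nonempty: "\<Omega> \<noteq> {}"
    and mesh: "tetrahedral_mesh \<Omega> \<T>"
begin

lemma finite_mesh: "finite \<T>" and Union_mesh: "\<Union>\<T> = closure \<Omega>"
  using mesh by (auto simp: tetrahedral_mesh_def triangulation_def)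

lemma domain_covered: "\<Omega> \<subseteq> \<Union>\<T>"
  unfolding Union_mesh by (rule closure_subset)

lemma element:
  assumes "T \<in> \<T>"
  shows "convex T" "compact T" "interior T \<noteq> {}" "T \<subseteq> closure \<Omega>" "interior (T \<inter> \<Omega>) \<noteq> {}"
proof -
  have "3 simplex T" using assms mesh by (auto simp: tetrahedral_mesh_def)
  note full_simplex_properties[OF this]
  moreover show "T \<subseteq> closure \<Omega>" using assms Union_mesh by blast
  ultimately show "convex T" "compact T" "interior T \<noteq> {}" "interior (T \<inter> \<Omega>) \<noteq> {}"
    using interior_Int_open_nonempty open_domain by auto
qed

text \<open>Access to the definite descriptions behind \<open>broken_grad\<close>: one polynomial
  \<open>q\<close> represents \<open>\<psi>\<close> on the element and has the broken gradient as
  its gradient at every point of space.\<close>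

lemma V_space_element:
  assumes "\<psi> \<in> V_space \<Omega> \<T> p" "T \<in> \<T>"
  obtains q where "poly_deg_le p q" "\<And>x. x \<in> T \<inter> \<Omega> \<Longrightarrow> \<psi> x = q x"
    "\<And>x. GDERIV q x :> broken_grad \<Omega> \<psi> T x"
    "\<And>j. poly_deg_le (p - 1) (\<lambda>x. broken_grad \<Omega> \<psi> T x $ j)"
proof -
  obtain q where q: "poly_deg_le p q" "\<And>x. x \<in> T \<inter> \<Omega> \<Longrightarrow> \<psi> x = q x"
    using assms unfolding V_space_def by blast
  obtain D where D: "\<And>x. GDERIV q x :> D x" "\<And>i. poly_deg_le (p - 1) (\<lambda>x. D x $ i)"
    using poly_deg_le_GDERIV[OF q(1)] by metis
  have "elem_poly (T \<inter> \<Omega>) \<psi> = q"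
    using q element(5)[OF assms(2)] poly_deg_le_imp_real_polynomial_function
    by (intro elem_poly_eq) auto
  then have "broken_grad \<Omega> \<psi> T x = D x" for x
    using gradient_eq[OF D(1)] by (simp add: broken_grad_def)
  then show ?thesis using that q D by simp
qed

lemma broken_grad_eq:
  assumes "poly_deg_le p q" "\<And>x. x \<in> T \<inter> \<Omega> \<Longrightarrow> \<psi> x = q x" "GDERIV q x :> D" "T \<in> \<T>"
  shows "broken_grad \<Omega> \<psi> T x = D"
proof -
  have "elem_poly (T \<inter> \<Omega>) \<psi> = q"
    using assms element(5) poly_deg_le_imp_real_polynomial_function by (intro elem_poly_eq) auto
  then show ?thesis using gradient_eq[OF assms(3)] by (simp add: broken_grad_def)
qed

text \<open>Continuity on the open set \<open>\<Omega>\<close> gives no bound near its boundary; the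
  bound comes from the finitely many polynomials on compact elements. Integrability is what makes
  the zero mean condition linear.\<close>

lemma V_space_set_integrable:
  assumes "\<psi> \<in> V_space \<Omega> \<T> p"
  shows "set_integrable lebesgue \<Omega> \<psi>"
proof -
  have "\<exists>B. \<forall>x\<in>T \<inter> \<Omega>. norm (\<psi> x) \<le> B" if T: "T \<in> \<T>" for T
  proof -
    obtain q where q: "poly_deg_le p q" "\<And>x. x \<in> T \<inter> \<Omega> \<Longrightarrow> \<psi> x = q x"
      using V_space_element[OF assms T] by metis
    have "bounded (q ` T)"
      by (intro compact_imp_bounded compact_continuous_image element(2)[OF T]
          real_polynomial_function_continuous_on poly_deg_le_imp_real_polynomial_function[OF q(1)])
    then obtain B where "\<And>y. y \<in> q ` T \<Longrightarrow> norm y \<le> B"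
      unfolding bounded_iff by blast
    then show ?thesis using q(2) by auto
  qed
  then obtain B where B: "\<And>T x. T \<in> \<T> \<Longrightarrow> x \<in> T \<inter> \<Omega> \<Longrightarrow> norm (\<psi> x) \<le> B T" by metis
  define M where "M = (\<Sum>T\<in>\<T>. \<bar>B T\<bar>)"
  have M: "norm (\<psi> x) \<le> M" if x: "x \<in> \<Omega>" for x
  proof -
    obtain T where T: "T \<in> \<T>" "x \<in> T" using x domain_covered by blast
    have "norm (\<psi> x) \<le> \<bar>B T\<bar>" using B[of T x] T x by force
    also have "\<dots> \<le> M" unfolding M_def using T finite_mesh by (intro member_le_sum) auto
    finally show ?thesis .
  qed
  let ?g = "\<lambda>x. indicator \<Omega> x *\<^sub>R \<psi> x"
  have "continuous_on \<Omega> \<psi>" using assms by (simp add: V_space_def)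
  then have meas: "?g \<in> borel_measurable lborel"
    using borel_measurable_continuous_on_indicator[of \<Omega> \<psi>] open_domain by simp
  have "integrable lborel ?g"
  proof (rule integrableI_bounded_set[of \<Omega>])
    show "emeasure lborel \<Omega> < \<infinity>" using bounded by (rule emeasure_bounded_finite)
    show "AE x in lborel. x \<in> \<Omega> \<longrightarrow> norm (?g x) \<le> M" using M by auto
    show "AE x in lborel. x \<notin> \<Omega> \<longrightarrow> ?g x = 0" by auto
  qed (use meas open_domain in auto)
  then show ?thesis using meas by (simp add: set_integrable_def integrable_completion)
qed

lemma V_space_0: "restrict (\<lambda>x. 0) \<Omega> \<in> V_space \<Omega> \<T> p"
proof -
  have "(LINT x:\<Omega>|lebesgue. restrict (\<lambda>x. 0) \<Omega> x) = (LINT x:\<Omega>|lebesgue. (0::real))"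
    unfolding set_lebesgue_integral_def by (rule Bochner_Integration.integral_cong) (auto simp: indicator_def)
  moreover have "continuous_on \<Omega> (restrict (\<lambda>x. 0::real) \<Omega>)"
    by (simp cong: continuous_on_cong)
  ultimately show ?thesis
    unfolding V_space_def using poly_deg_le_0 by (force simp: set_lebesgue_integral_def)
qed

lemma broken_grad_0: "T \<in> \<T> \<Longrightarrow> broken_grad \<Omega> (restrict (\<lambda>x. 0) \<Omega>) T x = 0"
  by (rule broken_grad_eq[OF poly_deg_le_0 _ GDERIV_const]) auto

text \<open>The combination with a single scalar covers sums, multiples and, with
  \<open>r = - 1\<close>, differences. Both claims rest on the same local polynomial
  \<open>q + r * s\<close>.\<close>

lemma
  assumes \<psi>: "\<psi> \<in> V_space \<Omega> \<T> p" and \<phi>: "\<phi> \<in> V_space \<Omega> \<T> p"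
  shows V_space_linear: "restrict (\<lambda>x. \<psi> x + r * \<phi> x) \<Omega> \<in> V_space \<Omega> \<T> p" (is "?\<chi> \<in> _")
    and broken_grad_linear: "T \<in> \<T> \<Longrightarrow> broken_grad \<Omega> (restrict (\<lambda>x. \<psi> x + r * \<phi> x) \<Omega>) T x =
      broken_grad \<Omega> \<psi> T x + r *\<^sub>R broken_grad \<Omega> \<phi> T x"
proof -
  have loc: "\<exists>q. poly_deg_le p q \<and> (\<forall>x\<in>T \<inter> \<Omega>. ?\<chi> x = q x) \<and>
      (\<forall>x. GDERIV q x :> (broken_grad \<Omega> \<psi> T x + r *\<^sub>R broken_grad \<Omega> \<phi> T x))" if T: "T \<in> \<T>" for T
  proof -
    obtain q where q: "poly_deg_le p q" "\<And>x. x \<in> T \<inter> \<Omega> \<Longrightarrow> \<psi> x = q x"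
      "\<And>x. GDERIV q x :> broken_grad \<Omega> \<psi> T x" using V_space_element[OF \<psi> T] by metis
    obtain s where s: "poly_deg_le p s" "\<And>x. x \<in> T \<inter> \<Omega> \<Longrightarrow> \<phi> x = s x"
      "\<And>x. GDERIV s x :> broken_grad \<Omega> \<phi> T x" using V_space_element[OF \<phi> T] by metis
    have "GDERIV (\<lambda>x. q x + r * s x) x :> broken_grad \<Omega> \<psi> T x + r *\<^sub>R broken_grad \<Omega> \<phi> T x" for x
      using GDERIV_add[OF q(3) GDERIV_mult[OF GDERIV_const[of r x] s(3)]] by simp
    moreover have "poly_deg_le p (\<lambda>x. q x + r * s x)"
      using q s by (intro poly_deg_le_add poly_deg_le_cmult)
    ultimately show ?thesis
      using q(2) s(2) by (intro exI[of _ "\<lambda>x. q x + r * s x"]) auto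
  qed
  show "T \<in> \<T> \<Longrightarrow> broken_grad \<Omega> ?\<chi> T x = broken_grad \<Omega> \<psi> T x + r *\<^sub>R broken_grad \<Omega> \<phi> T x"
    using loc[of T] broken_grad_eq by blast
  have "(LINT x:\<Omega>|lebesgue. ?\<chi> x) = (LINT x:\<Omega>|lebesgue. \<psi> x + r * \<phi> x)"
    unfolding set_lebesgue_integral_def by (rule Bochner_Integration.integral_cong) (auto simp: indicator_def)
  also have "\<dots> = (LINT x:\<Omega>|lebesgue. \<psi> x) + (LINT x:\<Omega>|lebesgue. r * \<phi> x)"
    using V_space_set_integrable[OF \<psi>] V_space_set_integrable[OF \<phi>] by (intro set_integral_add) auto
  also have "\<dots> = 0" using \<psi> \<phi> by (simp add: V_space_def)
  finally have "(LINT x:\<Omega>|lebesgue. ?\<chi> x) = 0" .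
  moreover have "continuous_on \<Omega> ?\<chi>"
    using \<psi> \<phi> by (auto simp: V_space_def cong: continuous_on_cong intro!: continuous_intros)
  ultimately show "?\<chi> \<in> V_space \<Omega> \<T> p"
    unfolding V_space_def using loc by blast
qed

text \<open>Counting values replaces an argument along chains of neighbouring elements. The zero
  mean then forces the constant to be zero, because a nonempty open set has positive
  measure.\<close>

lemma V_space_grad_0_imp_0:
  assumes \<psi>: "\<psi> \<in> V_space \<Omega> \<T> p"
    and grad: "\<And>T x. T \<in> \<T> \<Longrightarrow> broken_grad \<Omega> \<psi> T x = 0" and "x \<in> \<Omega>"
  shows "\<psi> x = 0"
proof -
  have "\<exists>c. \<forall>x\<in>T \<inter> \<Omega>. \<psi> x = c" if T: "T \<in> \<T>" for T
  proof -
    obtain q where q: "\<And>x. x \<in> T \<inter> \<Omega> \<Longrightarrow> \<psi> x = q x"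
      "\<And>x. GDERIV q x :> broken_grad \<Omega> \<psi> T x" using V_space_element[OF \<psi> T] by metis
    have "q x = q 0" for x using GDERIV_zero_imp_const[of q x 0] q(2) grad[OF T] by simp
    then show ?thesis using q(1) by metis
  qed
  then obtain c where c: "\<And>T x. T \<in> \<T> \<Longrightarrow> x \<in> T \<inter> \<Omega> \<Longrightarrow> \<psi> x = c T" by metis
  have "\<psi> x \<in> c ` \<T>" if x: "x \<in> \<Omega>" for x
  proof -
    obtain T where "T \<in> \<T>" "x \<in> T" using x domain_covered by blast
    then show ?thesis using c[of T x] x by simp
  qed
  then have "\<psi> ` \<Omega> \<subseteq> c ` \<T>" by (rule image_subsetI)
  then have "finite (\<psi> ` \<Omega>)" using finite_mesh finite_subset by blast
  moreover have "continuous_on \<Omega> \<psi>" using \<psi> by (simp add: V_space_def)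
  ultimately have "\<psi> constant_on \<Omega>" using connected continuous_finite_range_constant by blast
  then obtain d where d: "\<And>x. x \<in> \<Omega> \<Longrightarrow> \<psi> x = d" unfolding constant_on_def by blast
  have lm: "\<Omega> \<in> lmeasurable" using bounded open_domain by (rule lmeasurable_open)
  have "0 = (LINT x:\<Omega>|lebesgue. \<psi> x)" using \<psi> by (simp add: V_space_def)
  also have "\<dots> = (LINT x:\<Omega>|lebesgue. d)"
    unfolding set_lebesgue_integral_def by (rule Bochner_Integration.integral_cong) (auto simp: indicator_def d)
  also have "\<dots> = measure lebesgue \<Omega> * d"
    using lm by (subst set_integral_const) (auto simp: fmeasurable_def)
  finally have "measure lebesgue \<Omega> * d = 0" by simp
  moreover have "measure lebesgue \<Omega> \<noteq> 0"
    using open_not_negligible[OF open_domain nonempty] lm by (auto simp: negligible_iff_measure)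
  ultimately show ?thesis using d \<open>x \<in> \<Omega>\<close> by simp
qed

lemma V_space_eqI:
  assumes \<psi>: "\<psi> \<in> V_space \<Omega> \<T> p" and \<phi>: "\<phi> \<in> V_space \<Omega> \<T> p"
    and grad: "\<And>T x. T \<in> \<T> \<Longrightarrow> broken_grad \<Omega> \<psi> T x = broken_grad \<Omega> \<phi> T x"
  shows "\<psi> = \<phi>"
proof (rule extensionalityI[of _ \<Omega>])
  fix x assume x: "x \<in> \<Omega>"
  have "broken_grad \<Omega> (restrict (\<lambda>x. \<psi> x + - 1 * \<phi> x) \<Omega>) T y = 0" if "T \<in> \<T>" for T y
    unfolding broken_grad_linear[OF \<psi> \<phi> that] using grad[OF that] by simp
  from V_space_grad_0_imp_0[OF V_space_linear[OF \<psi> \<phi>] this x] show "\<psi> x = \<phi> x"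
    using x by simp
qed (use assms in \<open>auto simp: V_space_def\<close>)

end

subsection \<open>The discrete problem\<close>

text \<open>Two nested uses turn \<open>broken_field\<close> into a real vector space, so that
  \<open>subspace\<close>, \<open>span\<close> and \<open>linear\<close> apply to elementwise
  fields.\<close>

instantiation "fun" :: (type, real_vector) real_vector
begin

definition scaleR_fun :: "real \<Rightarrow> ('a \<Rightarrow> 'b) \<Rightarrow> 'a \<Rightarrow> 'b" where
  "scaleR_fun r f = (\<lambda>x. r *\<^sub>R f x)"

instance
  by standard (auto simp: scaleR_fun_def fun_eq_iff algebra_simps)

end

lemma scaleR_fun_apply [simp]: "(r *\<^sub>R f) x = r *\<^sub>R f x"
  by (simp add: scaleR_fun_def)

lemma sum_fun_apply: "sum f A x = (\<Sum>i\<in>A. f i x)"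
  by (induction A rule: infinite_finite_induct) auto

context mesh
begin

text \<open>Elements of \<^const>\<open>Q_space\<close> are \<^const>\<open>undefined\<close> off their domains, so they do not form a
  subspace under pointwise operations; unrestricted families of polynomials, zero off the mesh, do.\<close>

definition polynomial_families :: "broken_field set" where
  "polynomial_families = {q. (\<forall>T\<in>\<T>. \<forall>j. poly_deg_le (p - 1) (\<lambda>x. q T x $ j)) \<and> (\<forall>T. T \<notin> \<T> \<longrightarrow> q T = 0)}"

text \<open>The passage to \<open>Q_space\<close>. Quadrature points of an element lie in that
  element, so the quadrature product does not distinguish a family from its image.\<close>

definition on_elements :: "broken_field \<Rightarrow> broken_field" where
  "on_elements q = (\<lambda>T\<in>\<T>. restrict (q T) T)"

definition grad_family :: "(space3 \<Rightarrow> real) \<Rightarrow> broken_field" where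
  "grad_family \<psi> T = (if T \<in> \<T> then broken_grad \<Omega> \<psi> T else 0)"

lemma Q_space_eq: "Q_space \<T> p = on_elements ` polynomial_families"
proof (intro equalityI subsetI)
  fix b assume b: "b \<in> Q_space \<T> p"
  then have "\<exists>q. b T = restrict q T \<and> (\<forall>j. poly_deg_le (p - 1) (\<lambda>x. q x $ j))" if "T \<in> \<T>" for T
    using that unfolding Q_space_def PiE_iff by blast
  then obtain q where q: "\<And>T. T \<in> \<T> \<Longrightarrow> b T = restrict (q T) T"
    "\<And>T j. T \<in> \<T> \<Longrightarrow> poly_deg_le (p - 1) (\<lambda>x. q T x $ j)" by metis
  define r where "r T = (if T \<in> \<T> then q T else 0)" for T
  have "b = on_elements r"
    using b q(1) by (auto simp: on_elements_def r_def Q_space_def PiE_iff extensional_def fun_eq_iff)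
  moreover have "r \<in> polynomial_families"
    using q(2) by (auto simp: polynomial_families_def r_def)
  ultimately show "b \<in> on_elements ` polynomial_families" by blast
qed (auto simp: Q_space_def polynomial_families_def on_elements_def)

lemma subspace_polynomial_families: "subspace polynomial_families"
  unfolding subspace_def polynomial_families_def
  by (auto simp: poly_deg_le_0 poly_deg_le_add poly_deg_le_cmult)

text \<open>A spanning set consists of the fields \<open>e T j \<alpha>\<close>: one monomial in one
  coordinate direction on one element. The families being zero off the mesh leaves only finitely
  many indices \<open>T\<close>.\<close>

lemma polynomial_families_finite_span: "\<exists>B. finite B \<and> polynomial_families \<subseteq> span B"
proof -
  define e :: "space3 set \<Rightarrow> 3 \<Rightarrow> (3 \<Rightarrow> nat) \<Rightarrow> broken_field"
    where "e T j \<alpha> = (\<lambda>T' x. if T' = T then monomial \<alpha> x *\<^sub>R axis j 1 else 0)" for T j \<alpha>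
  define A where "A = {\<alpha> :: 3 \<Rightarrow> nat. sum \<alpha> UNIV \<le> p - 1}"
  define B where "B = (\<lambda>(T, j, \<alpha>). e T j \<alpha>) ` (\<T> \<times> UNIV \<times> A)"
  have "finite B"
    unfolding B_def A_def using finite_mesh finite_multi_indices[of "p - 1"] by simp
  moreover have "q \<in> span B" if q: "q \<in> polynomial_families" for q
  proof -
    have "\<exists>c. \<forall>x. q T x $ j = (\<Sum>\<alpha>\<in>A. c \<alpha> * monomial \<alpha> x)" if "T \<in> \<T>" for T j
      using q that unfolding polynomial_families_def poly_deg_le_def monomial_def A_def by blast
    then obtain c where c: "\<And>T j x. T \<in> \<T> \<Longrightarrow> q T x $ j = (\<Sum>\<alpha>\<in>A. c T j \<alpha> * monomial \<alpha> x)"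
      by metis
    have "q = (\<Sum>T\<in>\<T>. \<Sum>j\<in>UNIV. \<Sum>\<alpha>\<in>A. c T j \<alpha> *\<^sub>R e T j \<alpha>)" (is "q = ?s")
    proof (intro ext)
      fix T' x
      have s: "?s T' x = (\<Sum>T\<in>\<T>. if T = T' then \<Sum>j\<in>UNIV. \<Sum>\<alpha>\<in>A. c T j \<alpha> *\<^sub>R monomial \<alpha> x *\<^sub>R axis j 1 else 0)"
        by (auto simp: sum_fun_apply e_def intro!: sum.cong)
      show "q T' x = ?s T' x"
      proof (cases "T' \<in> \<T>")
        case True
        have "q T' x $ i = (\<Sum>j\<in>UNIV. \<Sum>\<alpha>\<in>A. c T' j \<alpha> *\<^sub>R monomial \<alpha> x *\<^sub>R axis j (1::real)) $ i" for i
        proof -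
          have "(\<Sum>j\<in>UNIV. \<Sum>\<alpha>\<in>A. c T' j \<alpha> *\<^sub>R monomial \<alpha> x *\<^sub>R axis j (1::real)) $ i =
              (\<Sum>j\<in>UNIV. if j = i then \<Sum>\<alpha>\<in>A. c T' j \<alpha> * monomial \<alpha> x else 0)"
            unfolding sum_component by (intro sum.cong refl) (auto simp: axis_def)
          then show ?thesis using c[OF True, of x i] by simp
        qed
        then show ?thesis using s True finite_mesh by (simp add: vec_eq_iff)
      next
        case False
        then have "?s T' x = 0" unfolding s by (intro sum.neutral) auto
        then show ?thesis using False q by (simp add: polynomial_families_def)
      qed
    qed
    also have "\<dots> \<in> span B"
      by (intro span_sum span_scale span_base) (force simp: B_def)
    finally show ?thesis .
  qed
  ultimately show ?thesis by blast
qed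

lemma grad_family_in_polynomial_families:
  assumes "\<psi> \<in> V_space \<Omega> \<T> p"
  shows "grad_family \<psi> \<in> polynomial_families"
  using V_space_element[OF assms] by (auto simp: polynomial_families_def grad_family_def)

lemma subspace_grad_families: "subspace (grad_family ` V_space \<Omega> \<T> p)"
proof (rule subspaceI)
  let ?V = "V_space \<Omega> \<T> p"
  have "0 = grad_family (restrict (\<lambda>x. 0) \<Omega>)"
    using broken_grad_0 by (auto simp: grad_family_def fun_eq_iff)
  then show zero: "0 \<in> grad_family ` ?V" using V_space_0 by blast
  have lin: "grad_family \<psi> + r *\<^sub>R grad_family \<phi> \<in> grad_family ` ?V" if "\<psi> \<in> ?V" "\<phi> \<in> ?V" for \<psi> \<phi> r
  proof -
    have "grad_family \<psi> + r *\<^sub>R grad_family \<phi> = grad_family (restrict (\<lambda>x. \<psi> x + r * \<phi> x) \<Omega>)"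
      using broken_grad_linear[OF that] by (auto simp: grad_family_def fun_eq_iff)
    then show ?thesis using V_space_linear[OF that] by blast
  qed
  fix a b assume a: "a \<in> grad_family ` ?V"
  show "r *\<^sub>R a \<in> grad_family ` ?V" for r
  proof -
    \<comment> \<open>A multiple is read as zero plus \<open>r\<close> times \<open>a\<close>, with
      the zero written as a gradient, so that the single closure property \<open>lin\<close>
      applies.\<close>
    obtain \<psi> \<phi> where "\<psi> \<in> ?V" "grad_family \<psi> = 0" "\<phi> \<in> ?V" "grad_family \<phi> = a"
      using zero a by (metis imageE)
    then show ?thesis using lin[of \<psi> \<phi> r] by simp
  qed
  assume "b \<in> grad_family ` ?V"
  then obtain \<psi> \<phi> where "\<psi> \<in> ?V" "grad_family \<psi> = a" "\<phi> \<in> ?V" "grad_family \<phi> = b"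
    using a by (metis imageE)
  then show "a + b \<in> grad_family ` ?V" using lin[of \<psi> \<phi> 1] by simp
qed

lemma grad_family_inj: "inj_on grad_family (V_space \<Omega> \<T> p)"
proof (rule inj_onI)
  fix \<psi> \<phi> assume *: "\<psi> \<in> V_space \<Omega> \<T> p" "\<phi> \<in> V_space \<Omega> \<T> p" and eq: "grad_family \<psi> = grad_family \<phi>"
  have "broken_grad \<Omega> \<psi> T x = broken_grad \<Omega> \<phi> T x" if "T \<in> \<T>" for T x
    using fun_cong[OF eq, of T] that by (simp add: grad_family_def)
  then show "\<psi> = \<phi>" using V_space_eqI[OF *] by blast
qed

text \<open>At a boundary point of \<open>\<Omega>\<close> the bounds pass to the limit, which is not vacuous because
  \<open>interior T \<inter> \<Omega>\<close> is dense in \<open>T\<close>.\<close>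

lemma material_field_bounds:
  assumes mono: "\<And>x b b'. x \<in> \<Omega> \<Longrightarrow>
      (grad_b w b x - grad_b w b' x) \<bullet> (b - b') \<ge> \<gamma> * (norm (b - b'))\<^sup>2"
    and lip: "\<And>x b b'. x \<in> \<Omega> \<Longrightarrow> norm (grad_b w b x - grad_b w b' x) \<le> L * norm (b - b')"
    and x: "T \<in> \<T>" "x \<in> T"
    and b: "continuous_on T (b T)" "material_field_defined_at w \<Omega> b T x"
    and b': "continuous_on T (b' T)" "material_field_defined_at w \<Omega> b' T x"
  shows "(material_field w \<Omega> b T x - material_field w \<Omega> b' T x) \<bullet> (b T x - b' T x)
      \<ge> \<gamma> * (norm (b T x - b' T x))\<^sup>2" (is ?mono)
    and "norm (material_field w \<Omega> b T x - material_field w \<Omega> b' T x) \<le> L * norm (b T x - b' T x)" (is ?lip)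
proof -
  have "?mono \<and> ?lip"
  proof (cases "x \<in> \<Omega>")
    case True
    then show ?thesis using mono lip by (simp add: material_field_def)
  next
    case False
    define F where "F = at x within T \<inter> \<Omega>"
    have F: "F \<noteq> bot"
      using islimpt_Int_open[OF element(1,3)[OF x(1)] open_domain element(4)[OF x(1)] x(2)]
      by (simp add: F_def trivial_limit_within)
    have inside: "eventually (\<lambda>y. y \<in> \<Omega>) F"
      unfolding F_def eventually_at_filter by (rule always_eventually) auto
    have lim: "((\<lambda>y. c T y) \<longlongrightarrow> c T x) F"
      "((\<lambda>y. grad_b w (c T y) y) \<longlongrightarrow> material_field w \<Omega> c T x) F"
      if c: "continuous_on T (c T)" "material_field_defined_at w \<Omega> c T x" for c
    proof -
      have "(c T \<longlongrightarrow> c T x) (at x within T)" using c(1) x(2) by (simp add: continuous_on_def)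
      then show "((\<lambda>y. c T y) \<longlongrightarrow> c T x) F"
        unfolding F_def by (rule tendsto_within_subset) simp
      obtain l where l: "((\<lambda>y. grad_b w (c T y) y) \<longlongrightarrow> l) F"
        using c(2) False unfolding material_field_defined_at_def F_def by blast
      then have "material_field w \<Omega> c T x = l"
        using tendsto_Lim[OF F l] False by (simp add: material_field_def F_def)
      then show "((\<lambda>y. grad_b w (c T y) y) \<longlongrightarrow> material_field w \<Omega> c T x) F" using l by simp
    qed
    note lims = lim[OF b] lim[OF b']
    have ?mono
    proof (rule tendsto_le[OF F])
      show "((\<lambda>y. (grad_b w (b T y) y - grad_b w (b' T y) y) \<bullet> (b T y - b' T y)) \<longlongrightarrow>
        (material_field w \<Omega> b T x - material_field w \<Omega> b' T x) \<bullet> (b T x - b' T x)) F"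
        by (intro tendsto_intros lims)
      show "((\<lambda>y. \<gamma> * (norm (b T y - b' T y))\<^sup>2) \<longlongrightarrow> \<gamma> * (norm (b T x - b' T x))\<^sup>2) F"
        by (intro tendsto_intros lims)
      show "\<forall>\<^sub>F y in F. \<gamma> * (norm (b T y - b' T y))\<^sup>2 \<le>
        (grad_b w (b T y) y - grad_b w (b' T y) y) \<bullet> (b T y - b' T y)"
        using inside by eventually_elim (rule mono)
    qed
    moreover have ?lip
    proof (rule tendsto_le[OF F])
      show "((\<lambda>y. norm (grad_b w (b T y) y - grad_b w (b' T y) y)) \<longlongrightarrow>
        norm (material_field w \<Omega> b T x - material_field w \<Omega> b' T x)) F"
        by (intro tendsto_intros lims)
      show "((\<lambda>y. L * norm (b T y - b' T y)) \<longlongrightarrow> L * norm (b T x - b' T x)) F"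
        by (intro tendsto_intros lims)
      show "\<forall>\<^sub>F y in F. norm (grad_b w (b T y) y - grad_b w (b' T y) y) \<le> L * norm (b T y - b' T y)"
        using inside by eventually_elim (rule lip)
    qed
    ultimately show ?thesis by blast
  qed
  then show ?mono ?lip by auto
qed

end

section \<open>The quadrature product as an inner product on polynomial families\<close>

locale mesh_quadrature = mesh +
  fixes n :: "space3 set \<Rightarrow> nat" and xq :: "space3 set \<Rightarrow> nat \<Rightarrow> space3"
    and \<omega> :: "space3 set \<Rightarrow> nat \<Rightarrow> real"
  assumes quadrature: "\<And>T. T \<in> \<T> \<Longrightarrow> quadrature_rule (2 * p - 2) T (n T) (xq T) (\<omega> T)"
begin

abbreviation ip :: "broken_field \<Rightarrow> broken_field \<Rightarrow> real" where
  "ip \<equiv> quad_prod \<T> n xq \<omega>"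

lemma quadrature_point: "T \<in> \<T> \<Longrightarrow> i < n T \<Longrightarrow> xq T i \<in> T"
  and weight_pos: "T \<in> \<T> \<Longrightarrow> i < n T \<Longrightarrow> \<omega> T i > 0"
  using quadrature by (auto simp: quadrature_rule_def)

lemma quad_prod_cong:
  assumes "\<And>T i. T \<in> \<T> \<Longrightarrow> i < n T \<Longrightarrow> a T (xq T i) = a' T (xq T i)"
    "\<And>T i. T \<in> \<T> \<Longrightarrow> i < n T \<Longrightarrow> b T (xq T i) = b' T (xq T i)"
  shows "ip a b = ip a' b'"
  unfolding quad_prod_def using assms by (intro sum.cong refl) auto

lemma linear_quad_prod: "linear (ip a)" "linear (\<lambda>a. ip a b)"
  by (rule linearI; simp add: quad_prod_def inner_add_left inner_add_right distrib_left
      sum.distrib sum_distrib_left mult.left_commute)+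

lemma quad_prod_mono:
  assumes "\<And>T i. T \<in> \<T> \<Longrightarrow> i < n T \<Longrightarrow>
    c * (a T (xq T i) \<bullet> b T (xq T i)) \<le> a' T (xq T i) \<bullet> b' T (xq T i)"
  shows "c * ip a b \<le> ip a' b'"
  unfolding quad_prod_def sum_distrib_left
proof (intro sum_mono)
  fix T i assume "T \<in> \<T>" "i \<in> {..<n T}"
  then show "c * (\<omega> T i * (a T (xq T i) \<bullet> b T (xq T i))) \<le> \<omega> T i * (a' T (xq T i) \<bullet> b' T (xq T i))"
    using assms[of T i] weight_pos[of T i] by (simp add: mult.left_commute[of c])
qed

lemma quad_prod_nonneg: "0 \<le> ip a a"
  using quad_prod_mono[of 0 0 0 a a] by simp

text \<open>Semidefiniteness holds for all broken fields. For definiteness, a vanishing sum of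
  nonnegative terms vanishes on each element separately, where exactness of the rule applies to a
  polynomial field.\<close>

sublocale finite_dim_inner ip polynomial_families
proof (rule finite_dim_inner.intro)
  show "linear (\<lambda>x. ip x y)" for y by (rule linear_quad_prod)
  show "ip x y = ip y x" for x y by (simp add: quad_prod_def inner_commute)
  show "0 \<le> ip x x" for x by (rule quad_prod_nonneg)
  show "subspace polynomial_families" by (rule subspace_polynomial_families)
  show "\<exists>B. finite B \<and> polynomial_families \<subseteq> span B" by (rule polynomial_families_finite_span)
  fix q assume q: "q \<in> polynomial_families" and zero: "ip q q = 0"
  have pos: "0 \<le> \<omega> T i * (q T (xq T i) \<bullet> q T (xq T i))" if "T \<in> \<T>" "i < n T" for T i
    using weight_pos[OF that] by simp
  have "q T = (\<lambda>x. 0)" if T: "T \<in> \<T>" for T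
  proof (rule quadrature_definite)
    have "2 * p - 2 = (p - 1) + (p - 1)" by simp
    then show "quadrature_rule ((p - 1) + (p - 1)) T (n T) (xq T) (\<omega> T)"
      using quadrature[OF T] by simp
    show "compact T" "interior T \<noteq> {}" using element[OF T] by auto
    show "poly_deg_le (p - 1) (\<lambda>x. q T x $ j)" for j using q T by (simp add: polynomial_families_def)
    have "\<forall>T\<in>\<T>. (\<Sum>i<n T. \<omega> T i * (q T (xq T i) \<bullet> q T (xq T i))) = 0"
      using zero finite_mesh pos unfolding quad_prod_def
      by (subst (asm) sum_nonneg_eq_0_iff) (auto intro: sum_nonneg)
    then show "(\<Sum>i<n T. \<omega> T i * (q T (xq T i) \<bullet> q T (xq T i))) = 0" using T by blast
  qed
  then have "q T x = 0" for T x using q by (cases "T \<in> \<T>") (auto simp: polynomial_families_def)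
  then show "q = 0" by (simp add: fun_eq_iff)
qed

text \<open>The pointwise bound is summed by the Cauchy-Schwarz inequality for finite sums over all
  pairs of an element and a point index, the square roots of the weights being absorbed into
  \<open>f\<close>. The fields may be arbitrary, as differences of material fields require.\<close>

lemma quad_prod_Lipschitz:
  assumes "\<And>T i. T \<in> \<T> \<Longrightarrow> i < n T \<Longrightarrow> norm (a T (xq T i)) \<le> L * norm (d T (xq T i))"
    and "L \<ge> 0"
  shows "ip a v \<le> L * nrm d * nrm v"
proof -
  define J where "J = (SIGMA T:\<T>. {..<n T})"
  define f where "f c = (\<lambda>(T, i). sqrt (\<omega> T i) * norm (c T (xq T i)))" for c :: broken_field
  have L2: "L2_set (f c) J = nrm c" for c
  proof -
    have "(\<Sum>j\<in>J. (f c j)\<^sup>2) = (\<Sum>T\<in>\<T>. \<Sum>i<n T. (f c (T, i))\<^sup>2)"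
      unfolding J_def using finite_mesh by (subst sum.Sigma) (auto simp: case_prod_beta)
    also have "\<dots> = ip c c"
      unfolding quad_prod_def f_def using weight_pos
      by (intro sum.cong refl) (auto simp: power_mult_distrib power2_norm_eq_inner less_imp_le)
    finally show ?thesis by (simp add: L2_set_def nrm_def)
  qed
  have "ip a v \<le> (\<Sum>T\<in>\<T>. \<Sum>i<n T. L * (\<bar>f d (T, i)\<bar> * \<bar>f v (T, i)\<bar>))"
    unfolding quad_prod_def
  proof (intro sum_mono)
    fix T i assume "T \<in> \<T>" "i \<in> {..<n T}"
    then have Ti: "T \<in> \<T>" "i < n T" by auto
    have "a T (xq T i) \<bullet> v T (xq T i) \<le> norm (a T (xq T i)) * norm (v T (xq T i))"
      by (rule norm_cauchy_schwarz)
    also have "\<dots> \<le> L * norm (d T (xq T i)) * norm (v T (xq T i))"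
      using assms(1)[OF Ti] by (rule mult_right_mono) simp
    finally have "\<omega> T i * (a T (xq T i) \<bullet> v T (xq T i)) \<le>
        (sqrt (\<omega> T i) * sqrt (\<omega> T i)) * (L * norm (d T (xq T i)) * norm (v T (xq T i)))"
      using weight_pos[OF Ti] by simp
    also have "\<dots> = L * (\<bar>f d (T, i)\<bar> * \<bar>f v (T, i)\<bar>)"
      using weight_pos[OF Ti] by (simp add: f_def abs_mult del: real_sqrt_mult_self)
    finally show "\<omega> T i * (a T (xq T i) \<bullet> v T (xq T i)) \<le> L * (\<bar>f d (T, i)\<bar> * \<bar>f v (T, i)\<bar>)" .
  qed
  also have "\<dots> = L * (\<Sum>j\<in>J. \<bar>f d j\<bar> * \<bar>f v j\<bar>)"
    unfolding J_def sum_distrib_left using finite_mesh by (subst sum.Sigma) (auto simp: case_prod_beta)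
  also have "\<dots> \<le> L * (L2_set (f d) J * L2_set (f v) J)"
    using assms(2) by (intro mult_left_mono L2_set_mult_ineq)
  finally show ?thesis by (simp add: L2)
qed

end

theorem lemma2:
  fixes \<Omega> :: "space3 set" and \<T> :: "space3 set set" and \<sigma> :: real and p :: nat
    and w :: "space3 \<Rightarrow> space3 \<Rightarrow> real" and \<gamma> L :: real
    and h\<^sub>s :: "space3 \<Rightarrow> space3"
    and n :: "space3 set \<Rightarrow> nat" and x\<^sub>q :: "space3 set \<Rightarrow> nat \<Rightarrow> space3"
    and \<omega> :: "space3 set \<Rightarrow> nat \<Rightarrow> real"
  assumes "bounded \<Omega>" and "simply_connected \<Omega>" and "lipschitz_domain \<Omega>"
    and "tetrahedral_mesh \<Omega> \<T>" and "shape_regular \<sigma> \<T>"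
    and "p \<ge> 1"
    and "\<And>x. x \<in> \<Omega> \<Longrightarrow> piecewise_smooth (\<lambda>b. w b x)"
    and "\<And>b. smooth_on \<Omega> (\<lambda>x. w b x)"
    and "\<And>x b. x \<in> \<Omega> \<Longrightarrow> (\<lambda>b. w b x) differentiable (at b)"
    and "\<gamma> > 0" and "L > 0"
    and "\<And>x b b'. x \<in> \<Omega> \<Longrightarrow>
           (grad_b w b x - grad_b w b' x) \<bullet> (b - b') \<ge> \<gamma> * (norm (b - b'))\<^sup>2"
    and "\<And>x b b'. x \<in> \<Omega> \<Longrightarrow> norm (grad_b w b x - grad_b w b' x) \<le> L * norm (b - b')"
    and "h\<^sub>s \<in> H_curl \<Omega>"
    and "\<And>T. T \<in> \<T> \<Longrightarrow> quadrature_rule (2 * p - 2) T (n T) (x\<^sub>q T) (\<omega> T)"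
    and "\<And>b T i. b \<in> Q_space \<T> p \<Longrightarrow> T \<in> \<T> \<Longrightarrow> i < n T \<Longrightarrow>
           material_field_defined_at w \<Omega> b T (x\<^sub>q T i)"
  shows "\<exists>!(b\<psi> :: broken_field \<times> (space3 \<Rightarrow> real)). case b\<psi> of (b\<^sub>h, \<psi>\<^sub>h) \<Rightarrow>
     b\<^sub>h \<in> Q_space \<T> p \<and> \<psi>\<^sub>h \<in> V_space \<Omega> \<T> p \<and>
     (\<forall>b' \<in> Q_space \<T> p.
        quad_prod \<T> n x\<^sub>q \<omega> (material_field w \<Omega> b\<^sub>h) b' +
        quad_prod \<T> n x\<^sub>q \<omega> (broken_grad \<Omega> \<psi>\<^sub>h) b' =
        quad_prod \<T> n x\<^sub>q \<omega> (\<lambda>T. h\<^sub>s) b') \<and>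
     (\<forall>\<psi>' \<in> V_space \<Omega> \<T> p.
        quad_prod \<T> n x\<^sub>q \<omega> b\<^sub>h (broken_grad \<Omega> \<psi>') = 0)"
proof -
  interpret mesh_quadrature \<Omega> \<T> p n x\<^sub>q \<omega>
    using assms by unfold_locales (auto simp: lipschitz_domain_def)
  define G where "G = grad_family ` V_space \<Omega> \<T> p"
  \<comment> \<open>The material field is formed from \<open>on_elements b\<close>, because its
    well-definedness at quadrature points is assumed for members of \<open>Q_space\<close>. The form
    is nonlinear in \<open>b\<close> and linear in the test field.\<close>
  define a where "a b = ip (material_field w \<Omega> (on_elements b))" for b
  define l where "l = ip (\<lambda>T. h\<^sub>s)"
  have on_elements_at: "on_elements q T y = q T y" if "T \<in> \<T>" "y \<in> T" for q T y
    using that by (simp add: on_elements_def)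
  have ip_on_elements: "ip v (on_elements b) = ip v b" "ip (on_elements b) v = ip b v" for v b
    by (rule quad_prod_cong; simp add: on_elements_at quadrature_point)+
  have ip_grad: "ip v (broken_grad \<Omega> \<psi>) = ip v (grad_family \<psi>)"
    "ip (broken_grad \<Omega> \<psi>) v = ip (grad_family \<psi>) v" for v \<psi>
    by (rule quad_prod_cong; simp add: grad_family_def)+
  have G_sub: "G \<subseteq> polynomial_families"
    unfolding G_def using grad_family_in_polynomial_families by blast
  have cont: "continuous_on T (on_elements b T)" if "b \<in> polynomial_families" "T \<in> \<T>" for b T
  proof -
    have "continuous_on T (\<lambda>y. b T y $ j)" for j
      using that by (auto simp: polynomial_families_def
          intro: real_polynomial_function_continuous_on poly_deg_le_imp_real_polynomial_function)
    then have "continuous_on T (b T)" by (subst continuous_on_componentwise) (auto simp: Basis_vec_def inner_axis)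
    then show ?thesis using that by (simp add: on_elements_def cong: continuous_on_cong)
  qed
  have bounds:
    "\<gamma> * (norm (b T (x\<^sub>q T i) - b' T (x\<^sub>q T i)))\<^sup>2 \<le>
      (material_field w \<Omega> (on_elements b) T (x\<^sub>q T i) - material_field w \<Omega> (on_elements b') T (x\<^sub>q T i))
        \<bullet> (b T (x\<^sub>q T i) - b' T (x\<^sub>q T i))"
    "norm (material_field w \<Omega> (on_elements b) T (x\<^sub>q T i) - material_field w \<Omega> (on_elements b') T (x\<^sub>q T i))
      \<le> L * norm (b T (x\<^sub>q T i) - b' T (x\<^sub>q T i))"
    if b: "b \<in> polynomial_families" "b' \<in> polynomial_families" and T: "T \<in> \<T>" "i < n T" for b b' T i
  proof -
    have defined: "material_field_defined_at w \<Omega> (on_elements c) T (x\<^sub>q T i)"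
      if "c \<in> polynomial_families" for c
      using assms(16)[OF _ T] that by (simp add: Q_space_eq)
    note material_field_bounds[where \<gamma> = \<gamma> and L = L and w = w, OF assms(12,13) T(1) quadrature_point[OF T]
        cont[OF b(1) T(1)] defined[OF b(1)] cont[OF b(2) T(1)] defined[OF b(2)]]
    then show
    "\<gamma> * (norm (b T (x\<^sub>q T i) - b' T (x\<^sub>q T i)))\<^sup>2 \<le>
      (material_field w \<Omega> (on_elements b) T (x\<^sub>q T i) - material_field w \<Omega> (on_elements b') T (x\<^sub>q T i))
        \<bullet> (b T (x\<^sub>q T i) - b' T (x\<^sub>q T i))"
    "norm (material_field w \<Omega> (on_elements b) T (x\<^sub>q T i) - material_field w \<Omega> (on_elements b') T (x\<^sub>q T i))
      \<le> L * norm (b T (x\<^sub>q T i) - b' T (x\<^sub>q T i))"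
      by (simp_all add: on_elements_at[OF T(1) quadrature_point[OF T]])
  qed
  \<comment> \<open>Although \<open>a\<close> is nonlinear in \<open>b\<close>, \<open>ip\<close> is
    linear in its first argument; so differences of \<open>a\<close> are products with a difference
    of material fields, to which the pointwise bounds apply.\<close>
  have diff: "a b v - a b' v =
      ip (material_field w \<Omega> (on_elements b) - material_field w \<Omega> (on_elements b')) v" for b b' v
    unfolding a_def using linear_diff[OF linear_quad_prod(2)] by metis
  \<comment> \<open>The discrete problem in the form of the abstract theorem: families in place of
    their restrictions, and gradients in place of potentials.\<close>
  define P where "P b g \<longleftrightarrow> b \<in> polynomial_families \<and> g \<in> G \<and>
      (\<forall>v\<in>polynomial_families. a b v + ip g v = l v) \<and> (\<forall>v\<in>G. ip b v = 0)" for b g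
  have ex1: "\<exists>!(b, g). P b g"
    unfolding P_def
  proof (rule saddle_point_unique)
    show "subspace G" unfolding G_def by (rule subspace_grad_families)
    show "G \<subseteq> polynomial_families" by (rule G_sub)
    show "linear (a b)" for b unfolding a_def by (rule linear_quad_prod)
    show "linear l" unfolding l_def by (rule linear_quad_prod)
    show "\<gamma> > 0" by fact
    fix b b' assume b: "b \<in> polynomial_families" "b' \<in> polynomial_families"
    show "\<gamma> * ip (b - b') (b - b') \<le> a b (b - b') - a b' (b - b')"
      unfolding diff
    proof (rule quad_prod_mono)
      fix T i assume "T \<in> \<T>" "i < n T"
      from bounds(1)[OF b this]
      show "\<gamma> * ((b - b') T (x\<^sub>q T i) \<bullet> (b - b') T (x\<^sub>q T i)) \<le>
        (material_field w \<Omega> (on_elements b) - material_field w \<Omega> (on_elements b')) T (x\<^sub>q T i) \<bullet>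
          (b - b') T (x\<^sub>q T i)"
        by (simp add: power2_norm_eq_inner)
    qed
    show "a b v - a b' v \<le> L * nrm (b - b') * nrm v" for v
      unfolding diff
    proof (rule quad_prod_Lipschitz)
      show "L \<ge> 0" using \<open>L > 0\<close> by simp
      fix T i assume "T \<in> \<T>" "i < n T"
      from bounds(2)[OF b this]
      show "norm ((material_field w \<Omega> (on_elements b) - material_field w \<Omega> (on_elements b')) T (x\<^sub>q T i))
        \<le> L * norm ((b - b') T (x\<^sub>q T i))" by simp
    qed
  qed
  then obtain bg where "case_prod P bg" by (rule ex1E)
  then obtain b g where sol: "P b g" by (cases bg) simp
  have uniq: "b' = b \<and> g' = g" if P': "P b' g'" for b' g'
  proof -
    have "(b', g') = (b, g)"
      by (rule Uniq_D[of "case_prod P"]) (use ex1 sol P' in \<open>simp_all add: ex1_iff_ex_Uniq\<close>)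
    then show ?thesis by simp
  qed
  obtain \<psi> where \<psi>: "\<psi> \<in> V_space \<Omega> \<T> p" "g = grad_family \<psi>" using sol by (auto simp: P_def G_def)
  show ?thesis
  proof (rule ex1I[of _ "(on_elements b, \<psi>)"], goal_cases)
    case 1
    then show ?case
      using sol \<psi> by (auto simp: P_def Q_space_eq ip_on_elements ip_grad G_def a_def l_def)
  next
    case (2 b\<psi>)
    \<comment> \<open>Any other solution is the image of some family \<open>b'\<close>, and the pair
      of \<open>b'\<close> and \<open>grad_family \<psi>'\<close> again satisfies \<open>P\<close>.
      Uniqueness there gives the same field, and injectivity of \<open>grad_family\<close> the same
      potential.\<close>
    then obtain b' \<psi>' where b': "b\<psi> = (on_elements b', \<psi>')" "b' \<in> polynomial_families"
        "\<psi>' \<in> V_space \<Omega> \<T> p"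
      and "P b' (grad_family \<psi>')"
      by (cases b\<psi>) (auto simp: P_def Q_space_eq ip_on_elements ip_grad G_def a_def l_def)
    then have "b' = b \<and> grad_family \<psi>' = g" by (intro uniq)
    then show ?case using b' \<psi> grad_family_inj by (auto dest: inj_onD)
  qed
qed

end
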